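(* Let $\Psi$ be an all-terminal reliability system (as in the context, $k=n$) satisfying $\mu_{\min}/\lambda_{\max}>m-1$ and having $N>1$ minimal cutsets. For every $\epsilon>0$ and $0<\delta<1$, the output of Algorithm B (described in the context) — namely $\tilde F_f^{\mathrm{MC}}$ if $p^*>n^{-4}$ and $\tilde F_f$ if $p^*\le n^{-4}$ — is an $(\epsilon,\delta)$-approximation of the steady-state failure frequency $F_f$, i.e. the output $Y$ satisfies $\Pr\{|Y-F_f|\ge\epsilon F_f\}\le\delta$.
   Context: System model. $\Psi$ is an undirected graph with $n$ nodes, all of which are terminals, and $m$ edges called components, indexed by $[m]$. Each component $i$ alternates between "available" and "unavailable"; up-times have mean $1/\lambda_i$, down-times mean $1/\mu_i$ ($\lambda_i,\mu_i>0$ constants), arbitrary distributions, stationary, statistically independent across components. In steady state component $i$ is unavailable with probability $p_i=\lambda_i/(\lambda_i+\mu_i)\in(0,1)$, independently across components; its weight is $w_i=-\log p_i$ (natural log). The system is unavailable if the subgraph of all nodes and available components is disconnected. $P_f$ is the steady-state probability of system unavailability and $F_f$ the steady-state failure frequency (expected number of transitions into the unavailable state per unit time). Equivalently, with a state written as its set $\mathcal I$ of unavailable components, $p(\mathcal I)=\prod_{i\in\mathcal I}p_i\prod_{i\notin\mathcal I}(1-p_i)$ and $\mathcal S_f$ the failed states, $F_f=\sum_{\mathcal I\in\mathcal S_f}p(\mathcal I)\big(\sum_{i\in\mathcal I}\mu_i-\sum_{i\notin\mathcal I}\lambda_i\big)$. Cutsets. A cutset is a minimal set of components whose simultaneous unavailability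 makes the system unavailable. For a set $\mathcal C$, $p(\mathcal C)=\prod_{i\in\mathcal C}p_i$, $w(\mathcal C)=\sum_{i\in\mathcal C}w_i$. $w^*$ is the minimum weight of a cutset and $p^*=e^{-w^*}$ the maximum of $p(\mathcal C)$ over cutsets. For $\alpha\ge1$, an $\alpha$-min cutset is a cutset $\mathcal C$ with $w(\mathcal C)\le\alpha w^*$. $\lambda_{\max}=\max_i\lambda_i$, $\mu_{\min}=\min_i\mu_i$, $w_{\max}=\max_iw_i$, $\mu=\sum_i\mu_i$. $(\xi,\delta)$-approximation: $\tilde X$ with $\Pr\{|\tilde X-X|\ge\xi X\}\le\delta$. KLM estimator with inputs $(Z_1,\dots,Z_M;P_Z;\xi,\delta)$ ($Z_j$ events defined by a random assignment, $P_Z(j)=\Pr\{Z_j\}$): with $Q_Z=\sum_jP_Z(j)$, $S=\lceil4(M-1)/\xi^2\rceil$, $T=\lceil12\log(1/\delta)\rceil$, for each $t\le T$, $s\le S$ independently choose $j$ with probability $P_Z(j)/Q_Z$, draw an assignment $\boldsymbol z$ from the random-assignment distribution conditioned on $Z_j$, and set $\pi_{s,t}=Q_Z/N(\boldsymbol z)$ where $N(\boldsymbol z)$ is the number of clauses satisfied by $\boldsymbol z$; output the median over $t$ of $\frac1S\sum_s\pi_{s,t}$. Random assignment: $x_1,\dots,x_m$ independent, $x_i$ true with probability $p_i$; independently one index $I$ is chosen with $\Pr\{I=i\}=\mu_i/\mu$, $y_I$ false and $y_i$ true for $i\neq I$. For a cutset $\mathcal C$: $X_{\mathcal C}=\bigwedge_{i\in\mathcal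 C}x_i$, $Z_{\mathcal C}=X_{\mathcal C}\wedge\bigwedge_{i\in\mathcal C}y_i$, $P_X(\mathcal C)=p(\mathcal C)$, $P_Z(\mathcal C)=p(\mathcal C)(1-\sum_{i\in\mathcal C}\mu_i/\mu)$. Monte Carlo simulation (MCS) with parameters $S,T$: for each $t\le T$, $s\le S$ independently draw a state (each component unavailable independently with probability $p_i$); if the system is unavailable set $\varphi_{s,t}=\sum_{i\text{ unavailable}}\mu_i-\sum_{i\text{ available}}\lambda_i$, else $\varphi_{s,t}=0$; output the median over $t$ of $\frac1S\sum_s\varphi_{s,t}$. Algorithm B (inputs $\{\lambda_i\},\{\mu_i\},\epsilon>0,0<\delta<1$): (0) find a minimum-weight cutset $\mathcal C^*$; compute $w^*=w(\mathcal C^* )$, $p^*=p(\mathcal C^* )$, $\mu_{\min},\lambda_{\max},w_{\max},\mu$, $\mu^*=\sum_{i\in\mathcal C^*}\mu_i$, $\hat s=\min\{\max\{w^*/w_{\max},1\},m\}$, $\rho=\mu_{\min}\hat s-\lambda_{\max}(m-\hat s)$. (1) If $p^*>n^{-4}$: return the output $\tilde F_f^{\mathrm{MC}}$ of MCS with $S=\lceil\mu(2+\epsilon)\log8/(p^*\rho\epsilon^2)\rceil$ and $T=\lceil12\log(1/\delta)\rceil$. (2) If $p^*\le n^{-4}$: set $\xi=(\epsilon/2)(\rho/\mu)$, $\gamma=w^*/\log n-2$, $\alpha=1+\frac2\gamma+\frac{\log\big(2(\gamma+2)(\mu-\hat s\mu_{\min})/(\xi\gamma(\mu-\mu^* ))\big)}{\gamma\log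 n}$; enumerate all $\alpha$-min cutsets; let $\tilde P^{(\alpha)}$ be the output of the KLM estimator with clauses $Z_{\mathcal C}$ and probabilities $P_Z(\mathcal C)$ over all $\alpha$-min cutsets $\mathcal C$, with parameters $(\xi/2,\delta/2)$; let $\tilde P_f^{(\alpha)}$ be the output of an independent run of the KLM estimator with clauses $X_{\mathcal C}$ and probabilities $P_X(\mathcal C)$ over all $\alpha$-min cutsets, with parameters $(\xi/2,\delta/2)$; return $\tilde F_f=(\tilde P_f^{(\alpha)}-\tilde P^{(\alpha)})\mu$.
   Formalization: The KLM estimator is taken to use at least one sample when there is a single α-min cutset (the stated S would be 0 and the mean 0/0), and to output 0 when there is no α-min cutset (α<1, for large ε), where the stated procedure is undefined. *)

theory Defs
  imports "HOL-Probability.Probability" "HOL-Probability.Product_PMF"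
begin

section \<open>All-terminal reliability systems\<close>

text \<open>Component \<open>i \<in> {1..comps \<Psi>}\<close> joins the nodes in \<open>ends \<Psi> i\<close>. Since components are
  indexed, parallel components are allowed.\<close>

record 'v rel_system =
  nodes :: "'v set"
  comps :: nat
  ends :: "nat \<Rightarrow> 'v set"
  fail_rate :: "nat \<Rightarrow> real"
  repair_rate :: "nat \<Rightarrow> real"

definition reliability_system :: "'v rel_system \<Rightarrow> bool" where
  "reliability_system \<Psi> \<longleftrightarrow>
     finite (nodes \<Psi>) \<and>
     (\<forall>i\<in>{1..comps \<Psi>}.
        (\<exists>u\<in>nodes \<Psi>. \<exists>v\<in>nodes \<Psi>. ends \<Psi> i = {u, v}) \<and>
        fail_rate \<Psi> i > 0 \<and> repair_rate \<Psi> i > 0)"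

definition links :: "'v rel_system \<Rightarrow> nat set \<Rightarrow> ('v \<times> 'v) set" where
  "links \<Psi> A = {(u, v). \<exists>i\<in>A. ends \<Psi> i = {u, v}}"

definition connected_by :: "'v rel_system \<Rightarrow> nat set \<Rightarrow> bool" where
  "connected_by \<Psi> A \<longleftrightarrow> (\<forall>u\<in>nodes \<Psi>. \<forall>v\<in>nodes \<Psi>. (u, v) \<in> (links \<Psi> A)\<^sup>*)"

text \<open>A state is represented by its set \<open>I\<close> of unavailable components.\<close>

definition failed :: "'v rel_system \<Rightarrow> nat set \<Rightarrow> bool" where
  "failed \<Psi> I \<longleftrightarrow> \<not> connected_by \<Psi> ({1..comps \<Psi>} - I)"

definition failed_states :: "'v rel_system \<Rightarrow> nat set set" where
  "failed_states \<Psi> = {I. I \<subseteq> {1..comps \<Psi>} \<and> failed \<Psi> I}"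

definition unavail :: "'v rel_system \<Rightarrow> nat \<Rightarrow> real" where
  "unavail \<Psi> i = fail_rate \<Psi> i / (fail_rate \<Psi> i + repair_rate \<Psi> i)"

definition state_prob :: "'v rel_system \<Rightarrow> nat set \<Rightarrow> real" where
  "state_prob \<Psi> I = (\<Prod>i\<in>I. unavail \<Psi> i) * (\<Prod>i\<in>{1..comps \<Psi>} - I. 1 - unavail \<Psi> i)"

definition rate_balance :: "'v rel_system \<Rightarrow> nat set \<Rightarrow> real" where
  "rate_balance \<Psi> I =
     (\<Sum>i\<in>I. repair_rate \<Psi> i) - (\<Sum>i\<in>{1..comps \<Psi>} - I. fail_rate \<Psi> i)"

definition failure_frequency :: "'v rel_system \<Rightarrow> real" where
  "failure_frequency \<Psi> = (\<Sum>I\<in>failed_states \<Psi>. state_prob \<Psi> I * rate_balance \<Psi> I)"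

section \<open>Cutsets\<close>

definition cutsets :: "'v rel_system \<Rightarrow> nat set set" where
  "cutsets \<Psi> = {C. C \<subseteq> {1..comps \<Psi>} \<and> failed \<Psi> C \<and> (\<forall>D. D \<subset> C \<longrightarrow> \<not> failed \<Psi> D)}"

definition weight :: "'v rel_system \<Rightarrow> nat \<Rightarrow> real" where
  "weight \<Psi> i = - ln (unavail \<Psi> i)"

definition set_prob :: "'v rel_system \<Rightarrow> nat set \<Rightarrow> real" where
  "set_prob \<Psi> C = (\<Prod>i\<in>C. unavail \<Psi> i)"

definition set_weight :: "'v rel_system \<Rightarrow> nat set \<Rightarrow> real" where
  "set_weight \<Psi> C = (\<Sum>i\<in>C. weight \<Psi> i)"

definition min_weight :: "'v rel_system \<Rightarrow> real" where
  "min_weight \<Psi> = Min (set_weight \<Psi> ` cutsets \<Psi>)"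

definition min_weight_cutset :: "'v rel_system \<Rightarrow> nat set \<Rightarrow> bool" where
  "min_weight_cutset \<Psi> C \<longleftrightarrow> C \<in> cutsets \<Psi> \<and> set_weight \<Psi> C = min_weight \<Psi>"

definition approx_min_cutsets :: "'v rel_system \<Rightarrow> real \<Rightarrow> nat set set" where
  "approx_min_cutsets \<Psi> \<alpha> = {C \<in> cutsets \<Psi>. set_weight \<Psi> C \<le> \<alpha> * min_weight \<Psi>}"

definition max_fail_rate :: "'v rel_system \<Rightarrow> real" where
  "max_fail_rate \<Psi> = Max (fail_rate \<Psi> ` {1..comps \<Psi>})"

definition min_repair_rate :: "'v rel_system \<Rightarrow> real" where
  "min_repair_rate \<Psi> = Min (repair_rate \<Psi> ` {1..comps \<Psi>})"

definition max_weight :: "'v rel_system \<Rightarrow> real" where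
  "max_weight \<Psi> = Max (weight \<Psi> ` {1..comps \<Psi>})"

definition total_repair_rate :: "'v rel_system \<Rightarrow> real" where
  "total_repair_rate \<Psi> = (\<Sum>i=1..comps \<Psi>. repair_rate \<Psi> i)"

section \<open>Randomized estimators\<close>

definition is_approximation :: "real pmf \<Rightarrow> real \<Rightarrow> real \<Rightarrow> real \<Rightarrow> bool" where
  "is_approximation Y X \<xi> \<delta> \<longleftrightarrow> measure_pmf.prob Y {y. \<bar>y - X\<bar> \<ge> \<xi> * X} \<le> \<delta>"

text \<open>For even length, the average of the two middle elements.\<close>

definition median :: "real list \<Rightarrow> real" where
  "median xs = (let ys = sort xs; k = length ys in (ys ! ((k - 1) div 2) + ys ! (k div 2)) / 2)"

definition median_of_means :: "nat \<Rightarrow> nat \<Rightarrow> real pmf \<Rightarrow> real pmf" where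
  "median_of_means S T q =
     map_pmf (\<lambda>v. median (map (\<lambda>t. (\<Sum>s=1..S. v (s, t)) / real S) [1..<Suc T]))
       (Pi_pmf ({1..S} \<times> {1..T}) 0 (\<lambda>_. q))"

definition weighted_pmf :: "'a set \<Rightarrow> ('a \<Rightarrow> real) \<Rightarrow> 'a pmf" where
  "weighted_pmf A f = embed_pmf (\<lambda>x. if x \<in> A then f x / sum f A else 0)"

lemma pmf_weighted_pmf:
  assumes "finite A" "\<And>x. x \<in> A \<Longrightarrow> f x \<ge> 0" "sum f A > 0"
  shows "pmf (weighted_pmf A f) x = (if x \<in> A then f x / sum f A else 0)"
  unfolding weighted_pmf_def
proof (rule pmf_embed_pmf)
  show "0 \<le> (if x \<in> A then f x / sum f A else 0)" for x
    using assms by auto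
  have "(\<integral>\<^sup>+x. ennreal (if x \<in> A then f x / sum f A else 0) \<partial>count_space UNIV) =
        (\<Sum>x\<in>A. ennreal (f x / sum f A))"
    by (subst nn_integral_count_space'[of A]) (auto intro!: assms(1) sum.cong)
  also have "\<dots> = ennreal (\<Sum>x\<in>A. f x / sum f A)"
    using assms by (intro sum_ennreal) auto
  also have "(\<Sum>x\<in>A. f x / sum f A) = 1"
    using assms(3) by (simp flip: sum_divide_distrib)
  finally show "(\<integral>\<^sup>+x. ennreal (if x \<in> A then f x / sum f A else 0) \<partial>count_space UNIV) = 1"
    by simp
qed

text \<open>The clauses are indexed by the finite set \<open>J\<close>; \<open>Z j\<close> is the set of assignments satisfying
  clause \<open>j\<close>, \<open>P j\<close> its probability under the random assignment \<open>D\<close>.\<close>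

definition klm_sample :: "'a pmf \<Rightarrow> 'c set \<Rightarrow> ('c \<Rightarrow> 'a set) \<Rightarrow> ('c \<Rightarrow> real) \<Rightarrow> real pmf" where
  "klm_sample D J Z P =
     bind_pmf (weighted_pmf J P) (\<lambda>j.
       map_pmf (\<lambda>z. sum P J / real (card {i\<in>J. z \<in> Z i})) (cond_pmf D (Z j)))"

text \<open>For a single clause \<open>\<lceil>4(M - 1)/\<xi>\<^sup>2\<rceil>\<close> is \<open>0\<close> and the mean over the samples would be
  meaningless; at least one sample is taken (it then equals the clause probability exactly). With
  no clause at all there is nothing to sample, and the estimate of the empty disjunction is \<open>0\<close>.\<close>

definition klm_estimator ::
    "'a pmf \<Rightarrow> 'c set \<Rightarrow> ('c \<Rightarrow> 'a set) \<Rightarrow> ('c \<Rightarrow> real) \<Rightarrow> real \<Rightarrow> real \<Rightarrow> real pmf" where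
  "klm_estimator D J Z P \<xi> \<delta> =
     (if J = {} then return_pmf 0
      else median_of_means (max 1 (nat \<lceil>4 * (real (card J) - 1) / \<xi>\<^sup>2\<rceil>)) (nat \<lceil>12 * ln (1 / \<delta>)\<rceil>)
             (klm_sample D J Z P))"

definition component_pmf :: "'v rel_system \<Rightarrow> (nat \<Rightarrow> bool) pmf" where
  "component_pmf \<Psi> = Pi_pmf {1..comps \<Psi>} False (\<lambda>i. bernoulli_pmf (unavail \<Psi> i))"

definition assignment_pmf :: "'v rel_system \<Rightarrow> ((nat \<Rightarrow> bool) \<times> (nat \<Rightarrow> bool)) pmf" where
  "assignment_pmf \<Psi> =
     map_pmf (\<lambda>(x, k). (x, \<lambda>i. i \<noteq> k))
       (pair_pmf (component_pmf \<Psi>) (weighted_pmf {1..comps \<Psi>} (repair_rate \<Psi>)))"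

definition X_clause :: "nat set \<Rightarrow> ((nat \<Rightarrow> bool) \<times> (nat \<Rightarrow> bool)) set" where
  "X_clause C = {(x, y). \<forall>i\<in>C. x i}"

definition Z_clause :: "nat set \<Rightarrow> ((nat \<Rightarrow> bool) \<times> (nat \<Rightarrow> bool)) set" where
  "Z_clause C = {(x, y). (\<forall>i\<in>C. x i) \<and> (\<forall>i\<in>C. y i)}"

definition X_prob :: "'v rel_system \<Rightarrow> nat set \<Rightarrow> real" where
  "X_prob \<Psi> C = set_prob \<Psi> C"

definition Z_prob :: "'v rel_system \<Rightarrow> nat set \<Rightarrow> real" where
  "Z_prob \<Psi> C = set_prob \<Psi> C * (1 - (\<Sum>i\<in>C. repair_rate \<Psi> i / total_repair_rate \<Psi>))"

definition mcs_sample :: "'v rel_system \<Rightarrow> real pmf" where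
  "mcs_sample \<Psi> =
     map_pmf (\<lambda>x. let I = {i\<in>{1..comps \<Psi>}. x i} in if failed \<Psi> I then rate_balance \<Psi> I else 0)
       (component_pmf \<Psi>)"

definition mcs :: "'v rel_system \<Rightarrow> nat \<Rightarrow> nat \<Rightarrow> real pmf" where
  "mcs \<Psi> S T = median_of_means S T (mcs_sample \<Psi>)"

text \<open>The output distribution of Algorithm B. The argument \<open>Cmin\<close> is the minimum-weight cutset
  found in its first step, which need not be unique.\<close>

definition algorithm_B :: "'v rel_system \<Rightarrow> nat set \<Rightarrow> real \<Rightarrow> real \<Rightarrow> real pmf" where
  "algorithm_B \<Psi> Cmin \<epsilon> \<delta> =
    (let n = real (card (nodes \<Psi>));
         m = real (comps \<Psi>);
         wmin = set_weight \<Psi> Cmin;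
         pmax = set_prob \<Psi> Cmin;
         \<mu>min = min_repair_rate \<Psi>;
         \<mu> = total_repair_rate \<Psi>;
         \<mu>C = (\<Sum>i\<in>Cmin. repair_rate \<Psi> i);
         s = min (max (wmin / max_weight \<Psi>) 1) m;
         \<rho> = \<mu>min * s - max_fail_rate \<Psi> * (m - s)
     in if pmax > n powr (-4)
        then mcs \<Psi> (nat \<lceil>\<mu> * (2 + \<epsilon>) * ln 8 / (pmax * \<rho> * \<epsilon>\<^sup>2)\<rceil>) (nat \<lceil>12 * ln (1 / \<delta>)\<rceil>)
        else
          (let \<xi> = (\<epsilon> / 2) * (\<rho> / \<mu>);
               \<gamma> = wmin / ln n - 2;
               \<alpha> = 1 + 2 / \<gamma> +
                    ln (2 * (\<gamma> + 2) * (\<mu> - s * \<mu>min) / (\<xi> * \<gamma> * (\<mu> - \<mu>C))) / (\<gamma> * ln n);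
               J = approx_min_cutsets \<Psi> \<alpha>
           in map_pmf (\<lambda>(a, b). (a - b) * \<mu>)
                (pair_pmf
                  (klm_estimator (assignment_pmf \<Psi>) J X_clause (X_prob \<Psi>) (\<xi> / 2) (\<delta> / 2))
                  (klm_estimator (assignment_pmf \<Psi>) J Z_clause (Z_prob \<Psi>) (\<xi> / 2) (\<delta> / 2)))))"

section \<open>Consistency of the failure frequency\<close>

lemma links_mono: "A \<subseteq> B \<Longrightarrow> links \<Psi> A \<subseteq> links \<Psi> B"
  by (auto simp: links_def)

lemma failed_mono:
  assumes "failed \<Psi> I" "I \<subseteq> J"
  shows "failed \<Psi> J"
proof -
  have "links \<Psi> ({1..comps \<Psi>} - J) \<subseteq> links \<Psi> ({1..comps \<Psi>} - I)"
    using assms(2) by (intro links_mono) auto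
  then have "(links \<Psi> ({1..comps \<Psi>} - J))\<^sup>* \<subseteq> (links \<Psi> ({1..comps \<Psi>} - I))\<^sup>*"
    by (rule rtrancl_mono)
  then show ?thesis
    using assms(1) unfolding failed_def connected_by_def by blast
qed

lemma detailed_balance:
  assumes "reliability_system \<Psi>" "I \<subseteq> {1..comps \<Psi>}" "i \<in> {1..comps \<Psi>} - I"
  shows "state_prob \<Psi> (insert i I) * repair_rate \<Psi> i = state_prob \<Psi> I * fail_rate \<Psi> i"
proof -
  define R where "R = {1..comps \<Psi>} - insert i I"
  have R: "{1..comps \<Psi>} - I = insert i R" "i \<notin> R" "finite R"
    using assms by (auto simp: R_def)
  have fin: "finite I" "i \<notin> I"
    using assms(2,3) finite_subset by auto
  have pos: "fail_rate \<Psi> i > 0" "repair_rate \<Psi> i > 0"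
    using assms by (auto simp: reliability_system_def)
  define K where "K = (\<Prod>j\<in>I. unavail \<Psi> j) * (\<Prod>j\<in>R. 1 - unavail \<Psi> j)"
  have 1: "state_prob \<Psi> (insert i I) = unavail \<Psi> i * K"
    unfolding state_prob_def R_def[symmetric] K_def using fin by simp
  have 2: "state_prob \<Psi> I = (1 - unavail \<Psi> i) * K"
    unfolding state_prob_def R(1) K_def using R by simp
  have "unavail \<Psi> i * repair_rate \<Psi> i = (1 - unavail \<Psi> i) * fail_rate \<Psi> i"
    using pos by (simp add: unavail_def field_simps)
  then have "unavail \<Psi> i * repair_rate \<Psi> i * K = (1 - unavail \<Psi> i) * fail_rate \<Psi> i * K"
    by (rule arg_cong)
  then show ?thesis
    unfolding 1 2 by (simp only: mult_ac)
qed

text \<open>The failure frequency is the steady-state rate of transitions from working to failed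
  states.\<close>

lemma failure_frequency_eq_transition_rate:
  assumes "reliability_system \<Psi>"
  shows "failure_frequency \<Psi> =
    (\<Sum>I\<in>{I. I \<subseteq> {1..comps \<Psi>} \<and> \<not> failed \<Psi> I}.
       state_prob \<Psi> I * (\<Sum>i\<in>{i\<in>{1..comps \<Psi>} - I. failed \<Psi> (insert i I)}. fail_rate \<Psi> i))"
proof -
  let ?E = "{1..comps \<Psi>}"
  let ?up = "{I. I \<subseteq> ?E \<and> \<not> failed \<Psi> I}"
  let ?g = "\<lambda>(I, i). state_prob \<Psi> I * fail_rate \<Psi> i"
  let ?A = "SIGMA I : failed_states \<Psi>. I"
  let ?B = "SIGMA I : failed_states \<Psi>. ?E - I"
  let ?D = "SIGMA I : ?up. {i\<in>?E - I. failed \<Psi> (insert i I)}"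
  have fin: "finite (failed_states \<Psi>)" "finite ?up"
    by (rule finite_subset[of _ "Pow ?E"]; force simp: failed_states_def)+
  have finI: "finite I" if "I \<in> failed_states \<Psi>" for I
    using that finite_subset[of I ?E] by (auto simp: failed_states_def)
  have "failure_frequency \<Psi> =
      (\<Sum>I\<in>failed_states \<Psi>. \<Sum>i\<in>I. state_prob \<Psi> I * repair_rate \<Psi> i) -
      (\<Sum>I\<in>failed_states \<Psi>. \<Sum>i\<in>?E - I. state_prob \<Psi> I * fail_rate \<Psi> i)"
    by (simp add: failure_frequency_def rate_balance_def right_diff_distrib sum_subtractf
        sum_distrib_left)
  also have "(\<Sum>I\<in>failed_states \<Psi>. \<Sum>i\<in>I. state_prob \<Psi> I * repair_rate \<Psi> i) =
      (\<Sum>(I, i)\<in>?A. state_prob \<Psi> I * repair_rate \<Psi> i)"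
    using fin finI by (subst sum.Sigma) auto
  also have "\<dots> = sum ?g (?B \<union> ?D)"
  proof (rule sum.reindex_bij_witness[where i = "\<lambda>(I, i). (insert i I, i)"
        and j = "\<lambda>(I, i). (I - {i}, i)"], goal_cases)
    case (1 a) then show ?case by (auto simp: failed_states_def)
  next
    case (2 a) then show ?case by (auto simp: failed_states_def insert_absorb)
  next
    case (3 b) then show ?case by (auto simp: failed_states_def)
  next
    case (4 b)
    then show ?case
      by (auto simp: failed_states_def intro: failed_mono[of \<Psi> _ "insert _ _"])
  next
    case (5 a)
    obtain I i where a: "a = (I, i)" by (cases a)
    with 5 have *: "I - {i} \<subseteq> ?E" "i \<in> ?E - (I - {i})" "insert i (I - {i}) = I"
      by (auto simp: failed_states_def)
    show ?case
      using detailed_balance[OF assms *(1,2)] *(3) by (simp add: a)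
  qed
  also have "\<dots> = sum ?g ?B + sum ?g ?D"
    using fin by (intro sum.union_disjoint) (auto simp: failed_states_def)
  also have "sum ?g ?B = (\<Sum>I\<in>failed_states \<Psi>. \<Sum>i\<in>?E - I. state_prob \<Psi> I * fail_rate \<Psi> i)"
    using fin by (subst sum.Sigma) auto
  also have "sum ?g ?D = (\<Sum>I\<in>?up. \<Sum>i\<in>{i\<in>?E - I. failed \<Psi> (insert i I)}.
      state_prob \<Psi> I * fail_rate \<Psi> i)"
    using fin by (subst sum.Sigma) auto
  finally show ?thesis
    by (simp add: sum_distrib_left)
qed

end

theory Submission
  imports Defs
begin

text \<open>Let \<open>P\<^sub>f\<close> be the probability that the system is failed and \<open>P\<close> the probability that it is still
  failed after repairing a component \<open>I\<close> drawn with probability \<open>\<mu>\<^sub>I/\<mu>\<close>. By detailed balance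
  \<open>F\<^sub>f = \<mu> (P\<^sub>f - P)\<close>, and since repairs dominate, \<open>\<rho> P\<^sub>f \<le> F\<^sub>f\<close>, so relative errors
  \<open>\<xi> = \<epsilon>\<rho>/(2\<mu>)\<close> of \<open>P\<^sub>f\<close> and \<open>P\<close> cost at most \<open>2\<xi>\<mu>P\<^sub>f \<le> \<epsilon>F\<^sub>f\<close>. Half of \<open>\<xi>\<close> pays for the sampling
  error. The other half pays for ignoring the heavy cutsets: by Karger's contraction argument at most
  \<open>n\<^sup>2\<^sup>a\<close> cuts have weight at most \<open>a w\<^sup>*\<close>, hence the ignored cutsets contribute at most
  \<open>(1 + 2/\<gamma>) n\<^sup>-\<^sup>\<alpha>\<^sup>\<gamma>\<close>, and \<open>\<alpha>\<close> is chosen to make this small compared with \<open>p\<^sup>*\<close>. All sampling errors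
  are controlled by Chebyshev's inequality for one mean of samples and a Chernoff bound for the median
  of the means; for the Monte Carlo simulation Chebyshev suffices because \<open>2 ln 8 \<ge> 4\<close>.\<close>

section \<open>Counting light cuts\<close>

text \<open>Edges are abstract indices with two endpoint maps: parallel edges and loops are allowed,
  and a contraction changes only the maps, never the edge set.\<close>

definition edge_cut :: "('e \<Rightarrow> 'v) \<Rightarrow> ('e \<Rightarrow> 'v) \<Rightarrow> 'e set \<Rightarrow> 'v set \<Rightarrow> 'e set" where
  "edge_cut f g E S = {e\<in>E. (f e \<in> S) \<noteq> (g e \<in> S)}"

text \<open>Cuts are collected as edge sets, so that the two sides of a cut do not count
  twice.\<close>

definition small_cuts ::
    "'v set \<Rightarrow> 'e set \<Rightarrow> ('e \<Rightarrow> 'v) \<Rightarrow> ('e \<Rightarrow> 'v) \<Rightarrow> ('e \<Rightarrow> real) \<Rightarrow> real \<Rightarrow> 'e set set" where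
  "small_cuts V E f g w a =
     edge_cut f g E ` {S. S \<subseteq> V \<and> S \<noteq> {} \<and> S \<noteq> V \<and> sum w (edge_cut f g E S) \<le> a}"

text \<open>A vertex set and its complement have the same cut, so every cut arises from a side that
  contains a fixed vertex \<open>v\<close>.\<close>

lemma card_small_cuts_le_power:
  assumes "finite V" "V \<noteq> {}" "f ` E \<subseteq> V" "g ` E \<subseteq> V"
  shows "card (small_cuts V E f g w a) \<le> 2 ^ (card V - 1)"
proof -
  obtain v where v: "v \<in> V" using assms(2) by auto
  have "small_cuts V E f g w a \<subseteq> (\<lambda>S. edge_cut f g E (insert v S)) ` Pow (V - {v})"
  proof
    fix C assume "C \<in> small_cuts V E f g w a"
    then obtain S where S: "S \<subseteq> V" "C = edge_cut f g E S" by (auto simp: small_cuts_def)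
    show "C \<in> (\<lambda>S. edge_cut f g E (insert v S)) ` Pow (V - {v})"
    proof (cases "v \<in> S")
      case True
      then have "insert v (S - {v}) = S" by auto
      then show ?thesis using S by (intro image_eqI[where x = "S - {v}"]) auto
    next
      case False
      then have "insert v (V - S - {v}) = V - S" using v by auto
      moreover have "edge_cut f g E (V - S) = C"
        using assms(3,4) S by (auto simp: edge_cut_def)
      ultimately show ?thesis using S by (intro image_eqI[where x = "V - S - {v}"]) auto
    qed
  qed
  then have "card (small_cuts V E f g w a) \<le> card (Pow (V - {v}))"
    using assms(1) by (meson card_image_le card_mono finite_Diff finite_Pow_iff finite_imageI le_trans)
  also have "\<dots> = 2 ^ (card V - 1)"
    using assms(1) v by (simp add: card_Pow)
  finally show ?thesis .
qed

text \<open>Handshake argument: an edge that is not a loop lies in exactly two stars, a loop in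
  none.\<close>

lemma sum_singleton_edge_cuts:
  fixes w :: "'e \<Rightarrow> real"
  assumes "finite V" "finite E" "f ` E \<subseteq> V" "g ` E \<subseteq> V"
  shows "(\<Sum>v\<in>V. sum w (edge_cut f g E {v})) = 2 * sum w {e\<in>E. f e \<noteq> g e}"
proof -
  have "(\<Sum>v\<in>V. sum w (edge_cut f g E {v})) =
      (\<Sum>v\<in>V. \<Sum>e\<in>E. if (f e = v) \<noteq> (g e = v) then w e else 0)"
    by (simp add: edge_cut_def sum.inter_filter assms(2))
  also have "\<dots> = (\<Sum>e\<in>E. \<Sum>v\<in>V. if (f e = v) \<noteq> (g e = v) then w e else 0)"
    by (rule sum.swap)
  also have "\<dots> = (\<Sum>e\<in>E. if f e \<noteq> g e then 2 * w e else 0)"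
  proof (rule sum.cong[OF refl])
    fix e assume e: "e \<in> E"
    have "(\<Sum>v\<in>V. if (f e = v) \<noteq> (g e = v) then w e else 0) =
        sum (\<lambda>_. w e) {v\<in>V. (f e = v) \<noteq> (g e = v)}"
      by (simp only: sum.inter_filter assms(1))
    also have "{v\<in>V. (f e = v) \<noteq> (g e = v)} = (if f e \<noteq> g e then {f e, g e} else {})"
      using e assms(3,4) by auto
    finally show "(\<Sum>v\<in>V. if (f e = v) \<noteq> (g e = v) then w e else 0) =
        (if f e \<noteq> g e then 2 * w e else 0)" by auto
  qed
  also have "\<dots> = 2 * sum w {e\<in>E. f e \<noteq> g e}"
    by (auto simp: sum.inter_filter assms(2) sum_distrib_left intro!: sum.cong)
  finally show ?thesis .
qed

text \<open>The contracted edge stays in \<open>E\<close> as a loop, so that the cuts of both graphs are subsets of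
  the same set.\<close>

lemma small_cuts_contract:
  fixes f g :: "'e \<Rightarrow> 'v"
  assumes "f ` E \<subseteq> V" "g ` E \<subseteq> V" "e \<in> E" "f e \<noteq> g e"
  defines "h \<equiv> \<lambda>v. if v = g e then f e else v"
  shows "{C \<in> small_cuts V E f g w a. e \<notin> C} \<subseteq> small_cuts (V - {g e}) E (h \<circ> f) (h \<circ> g) w a"
    and "S \<subseteq> V - {g e} \<Longrightarrow> S \<noteq> {} \<Longrightarrow> S \<noteq> V - {g e} \<Longrightarrow>
      \<exists>S'. S' \<subseteq> V \<and> S' \<noteq> {} \<and> S' \<noteq> V \<and> edge_cut (h \<circ> f) (h \<circ> g) E S = edge_cut f g E S'"
proof -
  have inV: "f e \<in> V" "g e \<in> V" using assms by auto
  show "{C \<in> small_cuts V E f g w a. e \<notin> C} \<subseteq> small_cuts (V - {g e}) E (h \<circ> f) (h \<circ> g) w a"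
  proof safe
    fix C assume C: "C \<in> small_cuts V E f g w a" "e \<notin> C"
    then obtain S where S: "S \<subseteq> V" "S \<noteq> {}" "S \<noteq> V" "sum w (edge_cut f g E S) \<le> a"
      "C = edge_cut f g E S" by (auto simp: small_cuts_def)
    \<comment> \<open>As \<open>e\<close> is not cut, its ends are on the same side, and dropping
      \<open>g e\<close> loses no information on \<open>S\<close>.\<close>
    have iff: "f e \<in> S \<longleftrightarrow> g e \<in> S" using C(2) S(5) assms(3) by (auto simp: edge_cut_def)
    have eq: "edge_cut (h \<circ> f) (h \<circ> g) E (S - {g e}) = edge_cut f g E S"
      using iff assms(4) by (auto simp: edge_cut_def h_def)
    have "S - {g e} \<noteq> {}" using S(2) iff assms(4) by auto
    moreover have "S - {g e} \<noteq> V - {g e}" using S(1,3) iff inV assms(4) by blast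
    ultimately show "C \<in> small_cuts (V - {g e}) E (h \<circ> f) (h \<circ> g) w a"
      unfolding small_cuts_def using S eq
      by (intro image_eqI[where x = "S - {g e}"]) auto
  qed
  assume S: "S \<subseteq> V - {g e}" "S \<noteq> {}" "S \<noteq> V - {g e}"
  \<comment> \<open>Undoing the contraction: \<open>g e\<close> rejoins the side of
    \<open>f e\<close>.\<close>
  define S' where "S' = (if f e \<in> S then insert (g e) S else S)"
  have "edge_cut (h \<circ> f) (h \<circ> g) E S = edge_cut f g E S'"
    using S(1) assms(4) by (auto simp: edge_cut_def h_def S'_def)
  moreover have "S' \<subseteq> V" "S' \<noteq> {}" using S inV by (auto simp: S'_def)
  moreover have "S' \<noteq> V"
  proof
    assume "S' = V"
    then have "S = V - {g e}" using S(1) inV by (auto simp: S'_def split: if_splits)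
    with S(3) show False by simp
  qed
  ultimately show "\<exists>S'. S' \<subseteq> V \<and> S' \<noteq> {} \<and> S' \<noteq> V \<and>
      edge_cut (h \<circ> f) (h \<circ> g) E S = edge_cut f g E S'" by blast
qed

section \<open>Karger's cut bound with a real exponent\<close>

lemma powr_le_Bernoulli:
  fixes x s :: real
  assumes "0 < x" "0 \<le> s" "s \<le> 1"
  shows "x powr s \<le> 1 + s * (x - 1)"
proof -
  \<comment> \<open>Weighted arithmetic-geometric mean of \<open>x\<close> and
    \<open>1\<close>.\<close>
  have "x powr s * 1 powr (1 - s) \<le> s * x + (1 - s) * 1"
    using assms by (intro Youngs_inequality_0) auto
  then show ?thesis by (simp add: algebra_simps)
qed

text \<open>For integral \<open>2\<alpha> = r\<close> (that is, \<open>\<theta> = 0\<close>) this is Karger's bound \<open>2\<^sup>r\<^sup>-\<^sup>1 \<cdot> (n choose r)\<close>; the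
  last factor interpolates between consecutive integers.\<close>

definition cut_count_bound :: "nat \<Rightarrow> real \<Rightarrow> nat \<Rightarrow> real" where
  "cut_count_bound r \<theta> n =
     2 ^ (r - 1) / fact r * (\<Prod>i<r - 1. real n - real i) * (real n - real r + 1) powr (1 - \<theta>)"

text \<open>At \<open>n = r\<close> the product runs from \<open>r\<close> down to \<open>2\<close>
  and the last power has base \<open>1\<close>. What remains is the trivial bound obtained by fixing
  a vertex, so the induction on the number of vertices can start here.\<close>

lemma cut_count_bound_self:
  assumes "r \<ge> 1"
  shows "cut_count_bound r \<theta> r = 2 ^ (r - 1)"
proof -
  have "(\<Prod>i<r - 1. real r - real i) = fact r"
    using assms
  proof (induction r rule: nat_induct_at_least)
    case (Suc r)
    then obtain k where "r = Suc k" by (cases r) auto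
    then show ?case using Suc by (simp add: prod.lessThan_Suc_shift add_diff_eq del: prod.lessThan_Suc)
  qed simp
  then show ?thesis by (simp add: cut_count_bound_def)
qed

text \<open>A random contraction in a graph on \<open>Suc n\<close> vertices preserves a light cut
  with probability at least \<open>1 - (r - \<theta>) / Suc n\<close>; this is the matching
  recurrence for the bound. It is an equality for \<open>\<theta> = 0\<close>.\<close>

lemma cut_count_bound_Suc:
  assumes "2 \<le> r" "r \<le> n" "0 \<le> \<theta>" "\<theta> < 1"
  shows "cut_count_bound r \<theta> n * real (Suc n) \<le>
    cut_count_bound r \<theta> (Suc n) * (real (Suc n) - (real r - \<theta>))"
proof -
  define N where "N = real n - real r + 1"
  have N: "N \<ge> 1" using assms by (simp add: N_def)
  define K where "K = 2 ^ (r - 1) / (fact r :: real)"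
  define Q where "Q = (\<Prod>i<r - 2. real n - real i)"
  obtain k where k: "r = Suc (Suc k)" using assms(1) by (metis add_2_eq_Suc le_Suc_ex)
  have 1: "(\<Prod>i<r - 1. real n - real i) = Q * (N + 1)"
    by (simp add: k Q_def N_def)
  have 2: "(\<Prod>i<r - 1. real (Suc n) - real i) = real (Suc n) * Q"
    by (simp add: k Q_def prod.lessThan_Suc_shift del: prod.lessThan_Suc)
  have Q0: "Q \<ge> 0" unfolding Q_def using assms by (intro prod_nonneg) auto
  have K0: "K \<ge> 0" by (simp add: K_def)
  \<comment> \<open>What is left after cancelling the common factors: Bernoulli's inequality at
    \<open>N / (N + 1)\<close> with exponent \<open>1 - \<theta>\<close>.\<close>
  have key: "(N + 1) * N powr (1 - \<theta>) \<le> (N + 1) powr (1 - \<theta>) * (N + \<theta>)"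
  proof -
    have "(N / (N + 1)) powr (1 - \<theta>) \<le> 1 + (1 - \<theta>) * (N / (N + 1) - 1)"
      using N assms by (intro powr_le_Bernoulli) auto
    also have "\<dots> = (N + \<theta>) / (N + 1)" using N by (simp add: field_simps)
    finally show ?thesis using N by (simp add: powr_divide field_simps)
  qed
  have "cut_count_bound r \<theta> n * real (Suc n) = K * Q * real (Suc n) * ((N + 1) * N powr (1 - \<theta>))"
    unfolding cut_count_bound_def 1 K_def[symmetric] by (simp add: N_def)
  also have "\<dots> \<le> K * Q * real (Suc n) * ((N + 1) powr (1 - \<theta>) * (N + \<theta>))"
    using Q0 K0 by (intro mult_left_mono key) auto
  also have "\<dots> = cut_count_bound r \<theta> (Suc n) * (real (Suc n) - (real r - \<theta>))"
    unfolding cut_count_bound_def 2 K_def[symmetric] by (simp add: N_def algebra_simps)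
  finally show ?thesis .
qed

text \<open>The quotient \<open>2 ^ (r - 1) / fact r\<close> is at most \<open>1\<close>, every
  other base is at most \<open>n\<close>, and the exponents \<open>r - 1\<close> and
  \<open>1 - \<theta>\<close> add up to \<open>r - \<theta>\<close>.\<close>

lemma cut_count_bound_le_powr:
  assumes "2 \<le> r" "r \<le> n" "0 \<le> \<theta>" "\<theta> < 1"
  shows "cut_count_bound r \<theta> n \<le> real n powr (real r - \<theta>)"
proof -
  have "(2::nat) ^ (r - 1) \<le> fact r"
    using assms(1)
  proof (induction r rule: nat_induct_at_least)
    case (Suc r)
    then have "(2::nat) ^ r = 2 * 2 ^ (r - 1)" by (cases r) auto
    also have "\<dots> \<le> Suc r * fact r" using Suc by (intro mult_mono) auto
    finally show ?case by simp
  qed simp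
  then have "(2::real) ^ (r - 1) \<le> fact r"
    by (metis of_nat_fact of_nat_le_iff of_nat_numeral of_nat_power)
  then have 1: "2 ^ (r - 1) / (fact r :: real) \<le> 1" by simp
  have "(\<Prod>i<r - 1. real n - real i) \<le> (\<Prod>i<r - 1. real n)"
    using assms by (intro prod_mono) auto
  then have 2: "(\<Prod>i<r - 1. real n - real i) \<le> real n powr (real r - 1)"
    using assms by (simp add: powr_realpow[symmetric] of_nat_diff)
  have 3: "(real n - real r + 1) powr (1 - \<theta>) \<le> real n powr (1 - \<theta>)"
    using assms by (intro powr_mono2) auto
  have "cut_count_bound r \<theta> n \<le> 1 * real n powr (real r - 1) * real n powr (1 - \<theta>)"
    unfolding cut_count_bound_def using assms
    by (intro mult_mono 1 2 3 mult_nonneg_nonneg prod_nonneg) auto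
  also have "\<dots> = real n powr (real r - \<theta>)"
    by (simp add: powr_add[symmetric])
  finally show ?thesis .
qed

text \<open>Karger's random contraction as a double count of the pairs of a light cut
  \<open>C\<close> and a non-loop outside \<open>C\<close>, weighted by \<open>w\<close>. With
  \<open>W\<close> the weight of all non-loops, each cut contributes at least
  \<open>W - \<alpha> * c\<close>, and each edge at most its weight times
  \<open>cut_count_bound r \<theta> n\<close>, because the cuts avoiding an edge survive its
  contraction.\<close>

lemma card_small_cuts_le_bound:
  fixes w :: "'e \<Rightarrow> real" and V :: "'v set"
  assumes "r \<le> n" "2 \<le> r" "0 \<le> \<theta>" "\<theta> < 1" "2 * \<alpha> = real r - \<theta>"
    and "finite E" "\<And>e. e \<in> E \<Longrightarrow> w e \<ge> 0" "c > 0"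
    and "finite V" "card V = n" "f ` E \<subseteq> V" "g ` E \<subseteq> V"
    and "\<And>S. S \<subseteq> V \<Longrightarrow> S \<noteq> {} \<Longrightarrow> S \<noteq> V \<Longrightarrow> sum w (edge_cut f g E S) \<ge> c"
  shows "real (card (small_cuts V E f g w (\<alpha> * c))) \<le> cut_count_bound r \<theta> n"
  using assms(1,9-)
proof (induction n arbitrary: V f g rule: dec_induct)
  case base
  then have "V \<noteq> {}" using assms(2) by auto
  then have "card (small_cuts V E f g w (\<alpha> * c)) \<le> 2 ^ (r - 1)"
    using card_small_cuts_le_power[of V f E g w "\<alpha> * c"] base by simp
  then have "real (card (small_cuts V E f g w (\<alpha> * c))) \<le> 2 ^ (r - 1)"
    by (metis of_nat_le_iff of_nat_numeral of_nat_power)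
  then show ?case using cut_count_bound_self[of r \<theta>] assms(2) by simp
next
  case (step n)
  let ?X = "small_cuts V E f g w (\<alpha> * c)"
  define L where "L = {e\<in>E. f e \<noteq> g e}"
  define W where "W = sum w L"
  have L: "finite L" "L \<subseteq> E" using assms(6) by (auto simp: L_def)
  have "finite ?X" unfolding small_cuts_def
    using step.prems(1) by (intro finite_imageI) auto
  have XL: "C \<subseteq> L" "sum w C \<le> \<alpha> * c" if "C \<in> ?X" for C
    using that by (auto simp: small_cuts_def edge_cut_def L_def)
  \<comment> \<open>Every star is a cut of weight at least \<open>c\<close>, so the handshake sum
    bounds \<open>W\<close> from below.\<close>
  have "real (Suc n) * c = (\<Sum>v\<in>V. c)" using step.prems by simp
  also have "\<dots> \<le> (\<Sum>v\<in>V. sum w (edge_cut f g E {v}))"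
  proof (rule sum_mono)
    fix v assume "v \<in> V"
    moreover have "V \<noteq> {v}" using step.prems(2) step.hyps assms(2) by auto
    ultimately show "c \<le> sum w (edge_cut f g E {v})" by (intro step.prems) auto
  qed
  also have "\<dots> = 2 * W" unfolding W_def L_def using step.prems assms(6)
    by (intro sum_singleton_edge_cuts) auto
  finally have Wc: "real (Suc n) * c \<le> 2 * W" .
  \<comment> \<open>Contracting \<open>e\<close> removes one vertex, and each cut of the contracted
    graph is a cut of the old one. Hence the lower bound \<open>c\<close> is inherited and the
    induction hypothesis applies.\<close>
  have contract: "real (card {C\<in>?X. e \<notin> C}) \<le> cut_count_bound r \<theta> n" if "e \<in> L" for e
  proof -
    have e: "e \<in> E" "f e \<noteq> g e" using that by (auto simp: L_def)
    define h where "h = (\<lambda>v. if v = g e then f e else v)"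
    have inV: "f e \<in> V" "g e \<in> V" using step.prems e by auto
    note con = small_cuts_contract[OF step.prems(3,4) e, folded h_def]
    have IH: "real (card (small_cuts (V - {g e}) E (h \<circ> f) (h \<circ> g) w (\<alpha> * c)))
        \<le> cut_count_bound r \<theta> n"
    proof (rule step.IH)
      show "finite (V - {g e})" "card (V - {g e}) = n" using step.prems inV by auto
      show "(h \<circ> f) ` E \<subseteq> V - {g e}" "(h \<circ> g) ` E \<subseteq> V - {g e}"
        using step.prems inV e by (auto simp: h_def)
      fix S assume "S \<subseteq> V - {g e}" "S \<noteq> {}" "S \<noteq> V - {g e}"
      from con(2)[OF this] obtain S' where "S' \<subseteq> V" "S' \<noteq> {}" "S' \<noteq> V"
        "edge_cut (h \<circ> f) (h \<circ> g) E S = edge_cut f g E S'" by blast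
      with step.prems(5)[of S'] show "c \<le> sum w (edge_cut (h \<circ> f) (h \<circ> g) E S)"
        by simp
    qed
    have "finite (small_cuts (V - {g e}) E (h \<circ> f) (h \<circ> g) w (\<alpha> * c))"
      unfolding small_cuts_def using step.prems(1) by (intro finite_imageI) auto
    then have "card {C\<in>?X. e \<notin> C} \<le> card (small_cuts (V - {g e}) E (h \<circ> f) (h \<circ> g) w (\<alpha> * c))"
      by (intro card_mono con(1))
    with IH show ?thesis by linarith
  qed
  \<comment> \<open>The double count: first per cut, then per edge after swapping the sums.\<close>
  have "(\<Sum>C\<in>?X. W - sum w C) = (\<Sum>C\<in>?X. \<Sum>e\<in>L. if e \<notin> C then w e else 0)"
  proof (rule sum.cong[OF refl])
    fix C assume "C \<in> ?X"
    then have "W - sum w C = sum w (L - C)"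
      unfolding W_def using XL L by (subst sum_diff) auto
    also have "L - C = {e\<in>L. e \<notin> C}" by auto
    finally show "W - sum w C = (\<Sum>e\<in>L. if e \<notin> C then w e else 0)"
      by (simp only: sum.inter_filter L)
  qed
  also have "\<dots> = (\<Sum>e\<in>L. w e * real (card {C\<in>?X. e \<notin> C}))"
  proof (subst sum.swap, rule sum.cong[OF refl])
    fix e
    have "(\<Sum>C\<in>?X. if e \<notin> C then w e else 0) = sum (\<lambda>_. w e) {C\<in>?X. e \<notin> C}"
      by (simp only: sum.inter_filter \<open>finite ?X\<close>)
    then show "(\<Sum>C\<in>?X. if e \<notin> C then w e else 0) = w e * real (card {C\<in>?X. e \<notin> C})"
      by simp
  qed
  also have "\<dots> \<le> (\<Sum>e\<in>L. w e * cut_count_bound r \<theta> n)"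
    using assms(7) L contract by (intro sum_mono mult_left_mono) auto
  also have "\<dots> = W * cut_count_bound r \<theta> n" by (simp add: W_def sum_distrib_right)
  finally have up: "(\<Sum>C\<in>?X. W - sum w C) \<le> W * cut_count_bound r \<theta> n" .
  have "real (card ?X) * (W - \<alpha> * c) \<le> (\<Sum>C\<in>?X. W - sum w C)"
    using sum_mono[of ?X "\<lambda>_. W - \<alpha> * c" "\<lambda>C. W - sum w C"] XL by auto
  with up have main: "real (card ?X) * (W - \<alpha> * c) \<le> W * cut_count_bound r \<theta> n" by linarith
  have Wpos: "W > 0" using Wc assms(8) by (smt (verit) mult_pos_pos of_nat_0_less_iff zero_less_Suc)
  have a0: "\<alpha> \<ge> 0" using assms by linarith
  have "\<alpha> * (real (Suc n) * c) \<le> \<alpha> * (2 * W)" using Wc a0 by (rule mult_left_mono)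
  then have "W * (real (Suc n) - 2 * \<alpha>) \<le> real (Suc n) * (W - \<alpha> * c)"
    by (simp add: algebra_simps)
  then have "real (card ?X) * (W * (real (Suc n) - 2 * \<alpha>)) \<le>
      real (card ?X) * (real (Suc n) * (W - \<alpha> * c))" by (intro mult_left_mono) auto
  also have "\<dots> = real (Suc n) * (real (card ?X) * (W - \<alpha> * c))" by simp
  also have "\<dots> \<le> real (Suc n) * (W * cut_count_bound r \<theta> n)"
    by (intro mult_left_mono main) auto
  also have "\<dots> = W * (cut_count_bound r \<theta> n * real (Suc n))" by simp
  also have "\<dots> \<le> W * (cut_count_bound r \<theta> (Suc n) * (real (Suc n) - (real r - \<theta>)))"
    using Wpos assms step.hyps by (intro mult_left_mono cut_count_bound_Suc) auto
  finally have "(real (card ?X) - cut_count_bound r \<theta> (Suc n)) * (W * (real (Suc n) - 2 * \<alpha>)) \<le> 0"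
    unfolding assms(5)[symmetric] by (simp add: algebra_simps)
  \<comment> \<open>Positive since \<open>2 * \<alpha> \<le> r < Suc n\<close>, so this factor can
    be cancelled.\<close>
  moreover have "W * (real (Suc n) - 2 * \<alpha>) > 0"
    using Wpos assms(3,5) step.hyps by (intro mult_pos_pos) auto
  ultimately show ?case by (smt (verit) mult_pos_pos)
qed

text \<open>Here \<open>r\<close> is \<open>2 * \<alpha>\<close> rounded up and
  \<open>\<theta>\<close> is the rounding defect.\<close>

theorem card_small_cuts_le:
  fixes w :: "'e \<Rightarrow> real" and V :: "'v set"
  assumes "finite E" "\<And>e. e \<in> E \<Longrightarrow> w e \<ge> 0" "c > 0" "\<alpha> \<ge> 1"
    and "finite V" "card V \<ge> 2" "f ` E \<subseteq> V" "g ` E \<subseteq> V"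
    and "\<And>S. S \<subseteq> V \<Longrightarrow> S \<noteq> {} \<Longrightarrow> S \<noteq> V \<Longrightarrow> sum w (edge_cut f g E S) \<ge> c"
  shows "real (card (small_cuts V E f g w (\<alpha> * c))) \<le> real (card V) powr (2 * \<alpha>)"
proof -
  define r where "r = nat \<lceil>2 * \<alpha>\<rceil>"
  define \<theta> where "\<theta> = real r - 2 * \<alpha>"
  have r: "2 \<le> r" "0 \<le> \<theta>" "\<theta> < 1" "2 * \<alpha> = real r - \<theta>"
    using assms(4) by (auto simp: r_def \<theta>_def) linarith+
  show ?thesis
  proof (cases "r \<le> card V")
    case True
    then show ?thesis
      using card_small_cuts_le_bound[OF True r assms(1-3,5) refl assms(7-9)]
        cut_count_bound_le_powr[OF r(1) True r(2,3)] r(4) by simp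
  next
    \<comment> \<open>Too few vertices for the contraction bound, but then
      \<open>card V - 1 \<le> 2 * \<alpha>\<close> and the trivial bound suffices.\<close>
    case False
    have "real (card (small_cuts V E f g w (\<alpha> * c))) \<le> 2 ^ (card V - 1)"
      using card_small_cuts_le_power[of V f E g w "\<alpha> * c"] assms
      by (metis card.empty not_numeral_le_zero of_nat_le_iff of_nat_numeral of_nat_power)
    also have "\<dots> = 2 powr real (card V - 1)" by (simp add: powr_realpow)
    also have "\<dots> \<le> real (card V) powr real (card V - 1)"
      using assms(6) by (intro powr_mono2) auto
    also have "\<dots> \<le> real (card V) powr (2 * \<alpha>)"
      using assms(6) False r by (intro powr_mono) linarith+
    finally show ?thesis .
  qed
qed

text \<open>Abel summation in integral form: the sum is the integral over \<open>t \<ge> a\<close>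
  of \<open>exp (- t)\<close> times a counting function, whose growth rate
  \<open>\<kappa> < 1\<close> lets the integral converge.\<close>

lemma sum_exp_minus_tail_le:
  fixes w :: "'a \<Rightarrow> real"
  assumes "finite A" "\<kappa> < 1" "\<And>t. real (card {x\<in>A. w x \<le> t}) \<le> exp (\<kappa> * t)"
  shows "(\<Sum>x | x \<in> A \<and> w x > a. exp (- w x)) \<le> exp (- (1 - \<kappa>) * a) / (1 - \<kappa>)"
proof -
  let ?B = "{x \<in> A. w x > a}"
  have fin: "finite ?B" using assms(1) by auto
  \<comment> \<open>Each \<open>exp (- w x)\<close> is the integral of \<open>exp (- t)\<close> over \<open>t \<ge> w x\<close>.\<close>
  have "((\<lambda>t. \<Sum>x\<in>?B. if t \<in> {w x..} then exp (- t) else 0) has_integral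
      (\<Sum>x\<in>?B. exp (- w x))) {a..}"
  proof (intro has_integral_sum fin)
    fix x assume "x \<in> ?B"
    then have "{w x..} \<subseteq> {a..}" by auto
    moreover have "((\<lambda>t. exp (- t)) has_integral exp (- w x)) {w x..}"
      using has_integral_exp_minus_to_infinity[of 1 "w x"] by simp
    ultimately show "((\<lambda>t. if t \<in> {w x..} then exp (- t) else 0) has_integral exp (- w x)) {a..}"
      by (subst has_integral_restrict)
  qed
  moreover have "((\<lambda>t. exp (- (1 - \<kappa>) * t)) has_integral exp (- (1 - \<kappa>) * a) / (1 - \<kappa>)) {a..}"
    using assms(2) by (intro has_integral_exp_minus_to_infinity) auto
  ultimately show ?thesis
  proof (rule has_integral_le)
    fix t
    have "(\<Sum>x\<in>?B. if t \<in> {w x..} then exp (- t) else 0) =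
        sum (\<lambda>_. exp (- t)) {x\<in>?B. t \<in> {w x..}}"
      by (simp only: sum.inter_filter fin)
    also have "\<dots> \<le> real (card {x\<in>A. w x \<le> t}) * exp (- t)"
      using assms(1) by (auto intro!: card_mono)
    also have "\<dots> \<le> exp (\<kappa> * t) * exp (- t)"
      by (intro mult_right_mono assms(3)) auto
    also have "\<dots> = exp (- (1 - \<kappa>) * t)"
      by (simp add: exp_add[symmetric] algebra_simps)
    finally show "(\<Sum>x\<in>?B. if t \<in> {w x..} then exp (- t) else 0) \<le> exp (- (1 - \<kappa>) * t)" .
  qed
qed

section \<open>Medians of means\<close>

text \<open>A grid of independent samples is an independent family of columns, which makes the means
  of the columns independent. Outside \<open>B\<close> a column is constantly \<open>d\<close>; this
  fixes the outer default value.\<close>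

lemma Pi_pmf_curry:
  assumes "finite A" "finite B"
  shows "map_pmf (\<lambda>v t s. v (s, t)) (Pi_pmf (A \<times> B) d (\<lambda>_. q)) =
    Pi_pmf B (\<lambda>_. d) (\<lambda>_. Pi_pmf A d (\<lambda>_. q))"
proof (rule pmf_eqI)
  fix F :: "'b \<Rightarrow> 'a \<Rightarrow> 'c"
  let ?c = "\<lambda>v t s. v (s, t) :: 'c"
  define v where "v = (\<lambda>(s, t). F t s)"
  have F: "F = ?c v" by (simp add: v_def)
  have "inj ?c" by (auto simp: inj_def fun_eq_iff)
  then have 1: "pmf (map_pmf ?c (Pi_pmf (A \<times> B) d (\<lambda>_. q))) F = pmf (Pi_pmf (A \<times> B) d (\<lambda>_. q)) v"
    unfolding F by (rule pmf_map_inj')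
  show "pmf (map_pmf ?c (Pi_pmf (A \<times> B) d (\<lambda>_. q))) F =
      pmf (Pi_pmf B (\<lambda>_. d) (\<lambda>_. Pi_pmf A d (\<lambda>_. q))) F"
  proof (cases "\<forall>x. x \<notin> A \<times> B \<longrightarrow> v x = d")
    case True
    then have *: "\<And>t. t \<notin> B \<Longrightarrow> F t = (\<lambda>_. d)" "\<And>t s. s \<notin> A \<Longrightarrow> F t s = d"
      by (auto simp: v_def)
    have "pmf (Pi_pmf (A \<times> B) d (\<lambda>_. q)) v = (\<Prod>x\<in>A \<times> B. pmf q (v x))"
      using True assms by (intro pmf_Pi') auto
    also have "\<dots> = (\<Prod>(s, t)\<in>A \<times> B. pmf q (F t s))"
      by (simp add: v_def case_prod_unfold)
    also have "\<dots> = (\<Prod>s\<in>A. \<Prod>t\<in>B. pmf q (F t s))"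
      by (rule prod.cartesian_product[symmetric])
    also have "\<dots> = (\<Prod>t\<in>B. \<Prod>s\<in>A. pmf q (F t s))"
      by (rule prod.swap)
    also have "\<dots> = pmf (Pi_pmf B (\<lambda>_. d) (\<lambda>_. Pi_pmf A d (\<lambda>_. q))) F"
      using * assms by (simp add: pmf_Pi')
    finally show ?thesis using 1 by simp
  next
    \<comment> \<open>A value off the grid that differs from the default has mass zero under both
      distributions.\<close>
    case False
    then obtain s t where st: "s \<notin> A \<or> t \<notin> B" "F t s \<noteq> d" by (auto simp: v_def)
    have "pmf (Pi_pmf B (\<lambda>_. d) (\<lambda>_. Pi_pmf A d (\<lambda>_. q))) F = 0"
    proof (cases "t \<in> B")
      case True
      then have "pmf (Pi_pmf A d (\<lambda>_. q)) (F t) = 0" using st assms by (intro pmf_Pi_outside) auto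
      with True show ?thesis using assms(2) by (auto simp: pmf_Pi)
    next
      case False
      then show ?thesis using st assms by (intro pmf_Pi_outside) (auto simp: fun_eq_iff)
    qed
    moreover have "pmf (Pi_pmf (A \<times> B) d (\<lambda>_. q)) v = 0"
      using False assms by (intro pmf_Pi_outside) auto
    ultimately show ?thesis using 1 by simp
  qed
qed

lemma finite_set_Pi_pmf:
  assumes "finite A" "\<And>x. x \<in> A \<Longrightarrow> finite (set_pmf (p x))"
  shows "finite (set_pmf (Pi_pmf A d p))"
  using assms by (subst set_Pi_pmf) (auto intro!: finite_PiE_dflt)

lemma expectation_pair_pmf_finite:
  fixes h :: "'a \<times> 'b \<Rightarrow> real"
  assumes "finite (set_pmf p)" "finite (set_pmf q)"
  shows "measure_pmf.expectation (pair_pmf p q) h =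
    measure_pmf.expectation p (\<lambda>a. measure_pmf.expectation q (\<lambda>b. h (a, b)))"
proof -
  have "measure_pmf.expectation (pair_pmf p q) h =
      (\<Sum>(a, b)\<in>set_pmf p \<times> set_pmf q. pmf p a * (pmf q b * h (a, b)))"
    using assms by (subst integral_measure_pmf[where A = "set_pmf p \<times> set_pmf q"])
      (auto simp: pmf_pair case_prod_unfold intro!: sum.cong)
  also have "\<dots> = (\<Sum>a\<in>set_pmf p. pmf p a * (\<Sum>b\<in>set_pmf q. pmf q b * h (a, b)))"
    by (simp add: sum.cartesian_product[symmetric] sum_distrib_left)
  also have "\<dots> = measure_pmf.expectation p (\<lambda>a. measure_pmf.expectation q (\<lambda>b. h (a, b)))"
    using assms by (simp add: integral_measure_pmf[where A = "set_pmf p"]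
        integral_measure_pmf[where A = "set_pmf q"])
  finally show ?thesis .
qed

lemma measure_pmf_finite_support:
  assumes "finite (set_pmf p)"
  shows "measure_pmf.prob p X = (\<Sum>x\<in>set_pmf p. if x \<in> X then pmf p x else 0)"
proof -
  have "measure_pmf.prob p X = measure_pmf.prob p {x \<in> set_pmf p. x \<in> X}"
    by (rule measure_prob_cong_0) (auto simp: set_pmf_iff)
  also have "\<dots> = sum (pmf p) {x \<in> set_pmf p. x \<in> X}"
    using assms by (intro measure_measure_pmf_finite) auto
  finally show ?thesis using assms by (simp only: sum.inter_filter)
qed

text \<open>Additivity of the variance. Both moments share one induction because the vanishing mean
  of the smaller sum kills the cross term in the second moment of the larger one.\<close>

lemma
  fixes q :: "real pmf"
  assumes "finite A" "finite (set_pmf q)" and X: "measure_pmf.expectation q (\<lambda>y. y) = X"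
  shows expectation_sum_centered_Pi_pmf:
      "measure_pmf.expectation (Pi_pmf A d (\<lambda>_. q)) (\<lambda>f. \<Sum>s\<in>A. f s - X) = 0"
    and second_moment_sum_centered_Pi_pmf:
      "measure_pmf.expectation (Pi_pmf A d (\<lambda>_. q)) (\<lambda>f. (\<Sum>s\<in>A. f s - X)\<^sup>2) =
        real (card A) * measure_pmf.expectation q (\<lambda>y. (y - X)\<^sup>2)"
  using assms(1)
proof (induction rule: finite_induct)
  case (insert a A)
  let ?P = "Pi_pmf A d (\<lambda>_. q)"
  have fin: "finite (set_pmf ?P)" using insert assms(2) by (intro finite_set_Pi_pmf) auto
  note int [simp] = integrable_measure_pmf_finite[OF assms(2)] integrable_measure_pmf_finite[OF fin]
  have upd: "(\<Sum>s\<in>insert a A. (f(a := y)) s - X) = (y - X) + (\<Sum>s\<in>A. f s - X)" for y f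
    using insert by (simp cong: sum.cong) (auto intro!: sum.cong)
  have E0: "measure_pmf.expectation q (\<lambda>y. y - X) = 0" using X by simp
  have ex: "measure_pmf.expectation (Pi_pmf (insert a A) d (\<lambda>_. q)) (\<lambda>f. h (\<Sum>s\<in>insert a A. f s - X)) =
      measure_pmf.expectation q (\<lambda>y. measure_pmf.expectation ?P (\<lambda>f. h ((y - X) + (\<Sum>s\<in>A. f s - X))))"
    for h :: "real \<Rightarrow> real"
    unfolding Pi_pmf_insert[OF insert(1,2)] integral_map_pmf case_prod_unfold
      expectation_pair_pmf_finite[OF assms(2) fin] fst_conv snd_conv upd ..
  show "measure_pmf.expectation (Pi_pmf (insert a A) d (\<lambda>_. q)) (\<lambda>f. \<Sum>s\<in>insert a A. f s - X) = 0"
    using ex[of "\<lambda>x. x"] E0 by (simp add: insert.IH(1))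
  have "measure_pmf.expectation ?P (\<lambda>f. ((y - X) + (\<Sum>s\<in>A. f s - X))\<^sup>2) =
      (y - X)\<^sup>2 + real (card A) * measure_pmf.expectation q (\<lambda>y. (y - X)\<^sup>2)" for y
    by (simp only: power2_sum Bochner_Integration.integral_add int insert.IH
        Bochner_Integration.integral_mult_right_zero) (simp add: insert.IH)
  then show "measure_pmf.expectation (Pi_pmf (insert a A) d (\<lambda>_. q)) (\<lambda>f. (\<Sum>s\<in>insert a A. f s - X)\<^sup>2) =
      real (card (insert a A)) * measure_pmf.expectation q (\<lambda>y. (y - X)\<^sup>2)"
    using ex[of "\<lambda>x. x\<^sup>2"] insert(1,2) by (simp add: algebra_simps)
qed auto

text \<open>Chebyshev's inequality; the second moment of the centered sum grows only linearly in
  \<open>card A\<close>.\<close>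

lemma prob_mean_Pi_pmf_le:
  fixes q :: "real pmf"
  assumes "finite (set_pmf q)" "measure_pmf.expectation q (\<lambda>y. y) = X"
    and "finite A" "A \<noteq> {}" "a > 0"
  shows "measure_pmf.prob (Pi_pmf A d (\<lambda>_. q)) {f. \<bar>(\<Sum>s\<in>A. f s) / real (card A) - X\<bar> \<ge> a}
    \<le> measure_pmf.expectation q (\<lambda>y. (y - X)\<^sup>2) / (real (card A) * a\<^sup>2)"
proof -
  let ?P = "Pi_pmf A d (\<lambda>_. q)"
  let ?n = "real (card A)"
  have n: "?n > 0" using assms by auto
  have fin: "finite (set_pmf ?P)" using assms by (intro finite_set_Pi_pmf) auto
  have "{f. \<bar>(\<Sum>s\<in>A. f s) / ?n - X\<bar> \<ge> a} = {f\<in>space (measure_pmf ?P). \<bar>\<Sum>s\<in>A. f s - X\<bar> \<ge> ?n * a}"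
  proof -
    have "(\<Sum>s\<in>A. f s) / ?n - X = (\<Sum>s\<in>A. f s - X) / ?n" for f
      using n by (simp add: sum_subtractf field_simps)
    then have "\<bar>(\<Sum>s\<in>A. f s) / ?n - X\<bar> \<ge> a \<longleftrightarrow> \<bar>\<Sum>s\<in>A. f s - X\<bar> \<ge> ?n * a" for f
      using n by (simp only: abs_divide) (simp add: pos_le_divide_eq mult.commute)
    then show ?thesis by simp
  qed
  then have "measure_pmf.prob ?P {f. \<bar>(\<Sum>s\<in>A. f s) / ?n - X\<bar> \<ge> a} \<le>
      measure_pmf.expectation ?P (\<lambda>f. (\<Sum>s\<in>A. f s - X)\<^sup>2) / (?n * a)\<^sup>2"
    using measure_pmf.second_moment_method[of "\<lambda>f. \<Sum>s\<in>A. f s - X" ?P "?n * a",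
        OF _ integrable_measure_pmf_finite[OF fin]] n assms(5) by simp
  also have "\<dots> = measure_pmf.expectation q (\<lambda>y. (y - X)\<^sup>2) / (?n * a\<^sup>2)"
    using n assms second_moment_sum_centered_Pi_pmf[OF assms(3,1,2)]
    by (simp add: power_mult_distrib power2_eq_square)
  finally show ?thesis .
qed

text \<open>Chernoff bound: a bad coordinate contributes the factor \<open>sqrt 3\<close>, a good
  one \<open>1 / sqrt 3\<close>. The product is at least \<open>1\<close> as soon as half of the
  coordinates are bad, while each factor has mean at most
  \<open>sqrt 3 / 4 + sqrt 3 / 4\<close>.\<close>

lemma prob_majority_Pi_pmf_le:
  assumes "finite I" "measure_pmf.prob p B \<le> 1/4"
  shows "measure_pmf.prob (Pi_pmf I d (\<lambda>_. p)) {v. card I \<le> 2 * card {t\<in>I. v t \<in> B}}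
    \<le> (sqrt 3 / 2) ^ card I"
proof -
  let ?P = "Pi_pmf I d (\<lambda>_. p)"
  \<comment> \<open>Exponential tilting: the odds ratio of \<open>1/2\<close> to \<open>1/4\<close> is \<open>3\<close>.\<close>
  define \<phi> where "\<phi> = (\<lambda>x. if x \<in> B then sqrt 3 else 1 / sqrt 3)"
  have prod: "(\<Prod>t\<in>I. \<phi> (v t)) = sqrt 3 ^ card {t\<in>I. v t \<in> B} * (1 / sqrt 3) ^ (card I - card {t\<in>I. v t \<in> B})"
    for v
  proof -
    have "I \<inter> {t. v t \<in> B} = {t\<in>I. v t \<in> B}" "I \<inter> - {t. v t \<in> B} = I - {t\<in>I. v t \<in> B}" by auto
    then show ?thesis
      using assms(1) by (simp add: \<phi>_def prod.If_cases card_Diff_subset)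
  qed
  have ge: "(\<Prod>t\<in>I. \<phi> (v t)) \<ge> 1" if "card I \<le> 2 * card {t\<in>I. v t \<in> B}" for v
  proof -
    let ?k = "card {t\<in>I. v t \<in> B}"
    have "sqrt 3 ^ (card I - ?k) \<le> sqrt 3 ^ ?k" using that by (intro power_increasing) auto
    then show ?thesis unfolding prod by (simp add: power_divide)
  qed
  have pos: "\<phi> x > 0" "\<phi> x \<le> sqrt 3" for x by (auto simp: \<phi>_def divide_simps)
  have int\<phi>: "integrable (measure_pmf p) \<phi>"
    by (rule measure_pmf.integrable_const_bound[where B = "sqrt 3"])
       (use pos in \<open>auto simp: less_imp_le\<close>)
  have "measure_pmf.prob ?P {v. card I \<le> 2 * card {t\<in>I. v t \<in> B}} =
      measure_pmf.expectation ?P (indicator {v. card I \<le> 2 * card {t\<in>I. v t \<in> B}})"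
    by simp
  also have "\<dots> \<le> measure_pmf.expectation ?P (\<lambda>v. \<Prod>t\<in>I. \<phi> (v t))"
  proof (rule integral_mono)
    show "integrable (measure_pmf ?P) (\<lambda>v. \<Prod>t\<in>I. \<phi> (v t))"
      using assms(1) int\<phi> by (intro integrable_prod_Pi_pmf) auto
    show "integrable (measure_pmf ?P) (indicator {v. card I \<le> 2 * card {t\<in>I. v t \<in> B}} :: _ \<Rightarrow> real)"
      by (rule measure_pmf.integrable_const_bound[where B = 1]) (auto simp: indicator_def)
    show "indicator {v. card I \<le> 2 * card {t\<in>I. v t \<in> B}} v \<le> (\<Prod>t\<in>I. \<phi> (v t))" for v
      using ge[of v] prod_nonneg[of I "\<lambda>t. \<phi> (v t)"] pos(1)
      by (auto simp: indicator_def less_imp_le)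
  qed
  also have "\<dots> = (\<Prod>t\<in>I. measure_pmf.expectation p \<phi>)"
    using assms(1) int\<phi> pos by (intro expectation_prod_Pi_pmf) (auto intro: less_imp_le)
  also have "\<dots> \<le> (\<Prod>t\<in>I. sqrt 3 / 2)"
  proof (intro prod_mono conjI)
    show "0 \<le> measure_pmf.expectation p \<phi>" by (intro Bochner_Integration.integral_nonneg) (simp add: less_imp_le pos)
    have intB: "integrable (measure_pmf p) (indicator B :: _ \<Rightarrow> real)"
      by (rule measure_pmf.integrable_const_bound[where B = 1]) (auto simp: indicator_def)
    have "\<phi> = (\<lambda>x. 1 / sqrt 3 + (sqrt 3 - 1 / sqrt 3) * indicator B x)"
      by (auto simp: \<phi>_def)
    then have "measure_pmf.expectation p \<phi> = 1 / sqrt 3 + (sqrt 3 - 1 / sqrt 3) * measure_pmf.prob p B"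
      by (simp add: intB)
    \<comment> \<open>The mean increases with the probability of \<open>B\<close>, so
      \<open>1/4\<close> is the worst case.\<close>
    also have "\<dots> \<le> 1 / sqrt 3 + (sqrt 3 - 1 / sqrt 3) * (1 / 4)"
      using assms(2) by (intro add_left_mono mult_left_mono) (auto simp: divide_simps)
    also have "\<dots> = sqrt 3 / 2" by (simp add: field_simps)
    finally show "measure_pmf.expectation p \<phi> \<le> sqrt 3 / 2" .
  qed
  also have "\<dots> = (sqrt 3 / 2) ^ card I" by simp
  finally show ?thesis .
qed

text \<open>A median of at least \<open>X + a\<close> forces the upper middle entry and everything
  after it to that height; the other side is symmetric. For even length this yields just half of the
  entries, hence the non-strict majority.\<close>

lemma majority_deviates_if_median_deviates:
  assumes "xs \<noteq> []" "\<bar>median xs - X\<bar> \<ge> a"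
  shows "length xs \<le> 2 * length (filter (\<lambda>x. \<bar>x - X\<bar> \<ge> a) xs)"
proof -
  define ys where "ys = sort xs"
  define k where "k = length ys"
  let ?P = "\<lambda>x. \<bar>x - X\<bar> \<ge> a"
  have k: "k > 0" "k = length xs" using assms(1) by (auto simp: k_def ys_def)
  have srt: "ys ! i \<le> ys ! j" if "i \<le> j" "j < k" for i j
    using that sorted_nth_mono[of ys i j] by (simp add: ys_def k_def)
  have len: "length (filter ?P xs) = card {i. i < k \<and> ?P (ys ! i)}"
  proof -
    have "length (filter ?P xs) = length (filter ?P ys)"
      by (metis mset_filter mset_sort size_mset ys_def)
    then show ?thesis by (simp add: length_filter_conv_card k_def)
  qed
  \<comment> \<open>Zero-based middle positions: equal for odd \<open>k\<close>, adjacent for even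
    \<open>k\<close>.\<close>
  define l u where "l = (k - 1) div 2" and "u = k div 2"
  have lu: "l \<le> u" "u < k" "l < k" using k(1) unfolding l_def u_def by arith+
  have med: "median xs = (ys ! l + ys ! u) / 2"
    by (simp add: median_def Let_def ys_def k_def l_def u_def)
  have "median xs \<ge> X + a \<or> median xs \<le> X - a" using assms(2) by linarith
  then have "k \<le> 2 * card {i. i < k \<and> ?P (ys ! i)}"
  proof
    assume "median xs \<ge> X + a"
    then have "ys ! u \<ge> X + a" using med srt[OF lu(1,2)] by (simp add: field_simps)
    then have "ys ! i \<ge> X + a" if "i \<in> {u..<k}" for i
      using that srt[of u i] by fastforce
    then have "{u..<k} \<subseteq> {i. i < k \<and> ?P (ys ! i)}" by fastforce
    then have "card {u..<k} \<le> card {i. i < k \<and> ?P (ys ! i)}" by (intro card_mono) auto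
    then show ?thesis by (simp add: u_def)
  next
    assume "median xs \<le> X - a"
    then have "ys ! l \<le> X - a" using med srt[OF lu(1,2)] by (simp add: field_simps)
    then have "ys ! i \<le> X - a" if "i \<in> {..l}" for i
      using that srt[of i l] lu(3) by fastforce
    then have "{..l} \<subseteq> {i. i < k \<and> ?P (ys ! i)}" using lu by fastforce
    then have "card {..l} \<le> card {i. i < k \<and> ?P (ys ! i)}" by (intro card_mono) auto
    then show ?thesis using k by (simp add: l_def)
  qed
  then show ?thesis using len k by simp
qed

text \<open>The variance condition makes each mean bad with probability at most \<open>1/4\<close>
  by Chebyshev; a bad median needs at least half of the independent means to be bad.\<close>

theorem median_of_means_deviation:
  assumes "finite (set_pmf q)" "measure_pmf.expectation q (\<lambda>y. y) = X"
    and "4 * measure_pmf.expectation q (\<lambda>y. (y - X)\<^sup>2) \<le> real S * a\<^sup>2" "a > 0" "S > 0"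
    and "0 < \<delta>" "\<delta> < 1"
  shows "measure_pmf.prob (median_of_means S (nat \<lceil>12 * ln (1 / \<delta>)\<rceil>) q) {y. \<bar>y - X\<bar> \<ge> a} \<le> \<delta>"
proof -
  define T where "T = nat \<lceil>12 * ln (1 / \<delta>)\<rceil>"
  define L where "L = ln (1 / \<delta>)"
  have L: "L > 0" using assms by (simp add: L_def)
  have T: "T > 0" "real T \<ge> 12 * L"
    using L unfolding T_def L_def[symmetric] by (auto simp: real_nat_ceiling_ge)
  let ?B = "Pi_pmf {1..S} 0 (\<lambda>_. q)"
  define bad where "bad = {f. \<bar>(\<Sum>s=1..S. f s) / real S - X\<bar> \<ge> a}"
  have "measure_pmf.prob ?B bad \<le> measure_pmf.expectation q (\<lambda>y. (y - X)\<^sup>2) / (real S * a\<^sup>2)"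
    using prob_mean_Pi_pmf_le[OF assms(1,2), of "{1..S}" a 0] assms by (simp add: bad_def)
  also have "\<dots> \<le> 1 / 4" using assms(3-5) by (simp add: divide_simps)
  finally have bad: "measure_pmf.prob ?B bad \<le> 1 / 4" .
  have "measure_pmf.prob (median_of_means S T q) {y. \<bar>y - X\<bar> \<ge> a} =
      measure_pmf.prob (Pi_pmf ({1..S} \<times> {1..T}) 0 (\<lambda>_. q))
        {v. \<bar>median (map (\<lambda>t. (\<Sum>s=1..S. v (s, t)) / real S) [1..<Suc T]) - X\<bar> \<ge> a}"
    by (simp add: median_of_means_def vimage_def)
  also have "\<dots> \<le> measure_pmf.prob (Pi_pmf ({1..S} \<times> {1..T}) 0 (\<lambda>_. q))
      ((\<lambda>v t s. v (s, t)) -` {v. card {1..T} \<le> 2 * card {t\<in>{1..T}. v t \<in> bad}})"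
  proof (rule measure_pmf.finite_measure_mono)
    show "{v. \<bar>median (map (\<lambda>t. (\<Sum>s=1..S. v (s, t)) / real S) [1..<Suc T]) - X\<bar> \<ge> a} \<subseteq>
      (\<lambda>v t s. v (s, t)) -` {v. card {1..T} \<le> 2 * card {t\<in>{1..T}. v t \<in> bad}}"
    proof (intro subsetI vimageI2 CollectI)
      fix v :: "nat \<times> nat \<Rightarrow> real"
      let ?m = "\<lambda>t. (\<Sum>s=1..S. v (s, t)) / real S"
      assume "v \<in> {v. \<bar>median (map (\<lambda>t. (\<Sum>s=1..S. v (s, t)) / real S) [1..<Suc T]) - X\<bar> \<ge> a}"
      then have "T \<le> 2 * length (filter (\<lambda>x. \<bar>x - X\<bar> \<ge> a) (map ?m [1..<Suc T]))"
        using majority_deviates_if_median_deviates[of "map ?m [1..<Suc T]" a X] T by simp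
      also have "length (filter (\<lambda>x. \<bar>x - X\<bar> \<ge> a) (map ?m [1..<Suc T])) =
          length (filter (\<lambda>t. \<bar>?m t - X\<bar> \<ge> a) [1..<Suc T])"
        by (simp add: filter_map o_def del: upt_Suc)
      also have "\<dots> = card {t\<in>{1..T}. \<bar>?m t - X\<bar> \<ge> a}"
        by (subst distinct_card[symmetric]) (auto simp del: upt_Suc intro!: arg_cong[where f = card])
      finally show "card {1..T} \<le> 2 * card {t\<in>{1..T}. (\<lambda>s. v (s, t)) \<in> bad}"
        by (simp add: bad_def)
    qed
  qed simp
  also have "\<dots> = measure_pmf.prob (Pi_pmf {1..T} (\<lambda>_. 0) (\<lambda>_. ?B))
      {v. card {1..T} \<le> 2 * card {t\<in>{1..T}. v t \<in> bad}}"
    by (subst Pi_pmf_curry[symmetric]) auto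
  also have "\<dots> \<le> (sqrt 3 / 2) ^ card {1..T}"
    by (intro prob_majority_Pi_pmf_le bad) auto
  also have "\<dots> = exp (real T * ln (sqrt 3 / 2))"
    by (simp add: exp_of_nat_mult)
  \<comment> \<open>Bounding the logarithm by \<open>- 1/8\<close> gives the exponent
    \<open>- 3/2 * L\<close>, more than the \<open>- L\<close> required.\<close>
  also have "\<dots> \<le> exp (12 * L * (- 1 / 8))"
  proof -
    have "ln (sqrt 3 / 2) = ln (3 / 4 :: real) / 2"
      by (simp add: ln_div ln_sqrt ln_mult[of 2 2, simplified])
    also have "ln (3 / 4 :: real) \<le> 3 / 4 - 1" by (rule ln_le_minus_one) simp
    finally have *: "ln (sqrt 3 / 2) \<le> - 1 / 8" by simp
    have "real T * ln (sqrt 3 / 2) \<le> real T * (- 1 / 8)" by (intro mult_left_mono *) auto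
    also have "\<dots> \<le> 12 * L * (- 1 / 8)" using T by simp
    finally show ?thesis by simp
  qed
  also have "\<dots> \<le> exp (- L)" using L by simp
  also have "\<dots> = \<delta>" using assms by (simp add: L_def ln_div)
  finally show ?thesis by (simp add: T_def)
qed

section \<open>The Karp-Luby-Madras estimator for a union of events\<close>

text \<open>The two-stage draw yields \<open>z\<close> with probability
  \<open>pmf D z * N z / sum P J\<close>: choosing clause \<open>j\<close> proportionally to
  \<open>P j\<close> cancels the normalisation of the conditioning, which leaves one equal term for
  each satisfied clause.\<close>

lemma expectation_klm_sample:
  fixes D :: "'a pmf" and h :: "real \<Rightarrow> real"
  assumes "finite (set_pmf D)" "finite J" "J \<noteq> {}"
    and P: "\<And>j. j \<in> J \<Longrightarrow> P j = measure_pmf.prob D (Z j)" "\<And>j. j \<in> J \<Longrightarrow> P j > 0"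
  defines "N \<equiv> \<lambda>z. real (card {i\<in>J. z \<in> Z i})"
  shows "finite (set_pmf (klm_sample D J Z P))"
    and "measure_pmf.expectation (klm_sample D J Z P) h =
      (\<Sum>z\<in>set_pmf D. pmf D z * N z / sum P J * h (sum P J / N z))"
proof -
  define Q where "Q = sum P J"
  have Q: "Q > 0" unfolding Q_def using assms by (intro sum_pos) auto
  have pw: "pmf (weighted_pmf J P) j = (if j \<in> J then P j / Q else 0)" for j
    using assms(2) P(2) Q unfolding Q_def by (intro pmf_weighted_pmf) (auto intro: less_imp_le)
  have setw: "set_pmf (weighted_pmf J P) \<subseteq> J"
    by (auto simp: set_pmf_iff pw split: if_splits)
  \<comment> \<open>Positive probability makes the conditioning on \<open>Z j\<close> well
    defined.\<close>
  have ne: "set_pmf D \<inter> Z j \<noteq> {}" if "j \<in> J" for j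
    using P[OF that] by (auto simp: measure_pmf_zero_iff[symmetric])
  define g where "g = (\<lambda>j. map_pmf (\<lambda>z. Q / N z) (cond_pmf D (Z j)))"
  have klm: "klm_sample D J Z P = bind_pmf (weighted_pmf J P) g"
    by (simp add: klm_sample_def g_def Q_def N_def)
  have fing: "finite (set_pmf (g j))" if "j \<in> J" for j
    using assms(1) ne[OF that] by (simp add: g_def)
  show "finite (set_pmf (klm_sample D J Z P))"
    unfolding klm using setw fing assms(2) by (auto intro: finite_subset)
  have Eg: "measure_pmf.expectation (g j) h =
      (\<Sum>z\<in>set_pmf D. (if z \<in> Z j then pmf D z / P j else 0) * h (Q / N z))" if "j \<in> J" for j
  proof -
    have "measure_pmf.expectation (cond_pmf D (Z j)) (\<lambda>z. h (Q / N z)) =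
        (\<Sum>z\<in>set_pmf D. pmf (cond_pmf D (Z j)) z *\<^sub>R h (Q / N z))"
      using assms(1) by (rule integral_measure_pmf) (simp add: set_cond_pmf[OF ne[OF that]])
    then show ?thesis by (simp add: g_def pmf_cond[OF ne[OF that]] P(1)[OF that] cong: if_cong)
  qed
  have "measure_pmf.expectation (klm_sample D J Z P) h =
      (\<Sum>j\<in>J. P j / Q * measure_pmf.expectation (g j) h)"
    unfolding klm using fing setw assms(2)
    by (subst pmf_expectation_bind[where A = J]) (auto simp: pw)
  also have "\<dots> = (\<Sum>j\<in>J. \<Sum>z\<in>set_pmf D. (if z \<in> Z j then 1 else 0) * (pmf D z / Q * h (Q / N z)))"
  proof (rule sum.cong[OF refl])
    fix j assume j: "j \<in> J"
    show "P j / Q * measure_pmf.expectation (g j) h =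
        (\<Sum>z\<in>set_pmf D. (if z \<in> Z j then 1 else 0) * (pmf D z / Q * h (Q / N z)))"
      unfolding Eg[OF j] sum_distrib_left using P(2)[OF j] by (intro sum.cong) auto
  qed
  also have "\<dots> = (\<Sum>z\<in>set_pmf D. (\<Sum>j\<in>J. if z \<in> Z j then 1 else 0) * (pmf D z / Q * h (Q / N z)))"
    by (subst sum.swap) (simp only: sum_distrib_right)
  also have "(\<lambda>z. \<Sum>j\<in>J. if z \<in> Z j then 1 else 0) = N"
    using assms(2) by (auto simp: N_def sum.If_cases Int_def)
  finally show "measure_pmf.expectation (klm_sample D J Z P) h =
      (\<Sum>z\<in>set_pmf D. pmf D z * N z / sum P J * h (sum P J / N z))"
    by (simp add: Q_def mult_ac)
qed

text \<open>A sample has mean \<open>A\<close> because \<open>N z\<close> cancels. As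
  \<open>N z \<ge> 1\<close> on the union, the second moment is at most \<open>Q * A\<close>, and
  \<open>Q \<le> card J * A\<close>, so the variance is at most
  \<open>(card J - 1) * A\<^sup>2\<close>. The deviation is strict because for \<open>J = {}\<close>
  the estimate and \<open>A\<close> are both \<open>0\<close>.\<close>

theorem klm_estimator_deviation:
  fixes D :: "'a pmf"
  assumes "finite (set_pmf D)" "finite J"
    and P: "\<And>j. j \<in> J \<Longrightarrow> P j = measure_pmf.prob D (Z j)" "\<And>j. j \<in> J \<Longrightarrow> P j > 0"
    and "\<xi> > 0" "0 < \<delta>" "\<delta> < 1"
  defines "A \<equiv> measure_pmf.prob D (\<Union>j\<in>J. Z j)"
  shows "measure_pmf.prob (klm_estimator D J Z P \<xi> \<delta>) {y. \<bar>y - A\<bar> > \<xi> * A} \<le> \<delta>"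
proof (cases "J = {}")
  case True
  then show ?thesis using assms by (simp add: klm_estimator_def)
next
  case False
  define Q where "Q = sum P J"
  define N where "N z = real (card {i\<in>J. z \<in> Z i})" for z
  let ?K = "klm_sample D J Z P"
  have fin: "finite (set_pmf ?K)"
    using assms(1,2) False P by (rule expectation_klm_sample(1))
  have E: "measure_pmf.expectation ?K h = (\<Sum>z\<in>set_pmf D. pmf D z * N z / Q * h (Q / N z))" for h
    unfolding N_def Q_def using assms(1,2) False P by (rule expectation_klm_sample(2))
  have Q: "Q > 0" unfolding Q_def using assms(2) False P by (intro sum_pos) auto
  have N: "N z = 0 \<longleftrightarrow> z \<notin> (\<Union>j\<in>J. Z j)" "N z \<ge> 1 \<longleftrightarrow> N z \<noteq> 0" for z
    using assms(2) by (auto simp: N_def Suc_le_eq card_gt_0_iff)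
  have A: "A = (\<Sum>z\<in>set_pmf D. if N z \<noteq> 0 then pmf D z else 0)"
    unfolding A_def N(1) using assms(1) by (simp add: measure_pmf_finite_support)
  have PA: "P j \<le> A" if "j \<in> J" for j
    unfolding A_def P(1)[OF that] using that by (intro measure_pmf.finite_measure_mono) auto
  have Apos: "A > 0" using False PA P(2) by (meson ex_in_conv less_le_trans)
  have QA: "Q \<le> real (card J) * A" unfolding Q_def using sum_mono[of J P "\<lambda>_. A"] PA by simp
  have E1: "measure_pmf.expectation ?K (\<lambda>y. y) = A"
    unfolding A E[of "\<lambda>y. y"] using Q by (intro sum.cong) auto
  have E2: "measure_pmf.expectation ?K (\<lambda>y. y\<^sup>2) \<le> Q * A"
    unfolding A E[of "\<lambda>y. y\<^sup>2"] sum_distrib_left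
  proof (rule sum_mono)
    fix z
    show "pmf D z * N z / Q * (Q / N z)\<^sup>2 \<le> Q * (if N z \<noteq> 0 then pmf D z else 0)"
    proof (cases "N z = 0")
      case False
      then have "N z \<ge> 1" using N(2) by simp
      then have "pmf D z * (Q / N z) \<le> pmf D z * (Q / 1)"
        using Q by (intro mult_left_mono divide_left_mono) auto
      then show ?thesis using False Q by (simp add: power2_eq_square mult_ac)
    qed simp
  qed
  note int = integrable_measure_pmf_finite[OF fin]
  have "measure_pmf.expectation ?K (\<lambda>y. (y - A)\<^sup>2) =
      measure_pmf.expectation ?K (\<lambda>y. y\<^sup>2) - 2 * A * measure_pmf.expectation ?K (\<lambda>y. y) + A\<^sup>2"
    by (simp add: power2_diff int mult.commute)
  then have var: "measure_pmf.expectation ?K (\<lambda>y. (y - A)\<^sup>2) \<le> (real (card J) - 1) * A\<^sup>2"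
    using E1 E2 mult_right_mono[OF QA, of A] Apos
    by (simp only: power2_eq_square left_diff_distrib mult.assoc) linarith
  \<comment> \<open>For a single clause the variance bound is \<open>0\<close>; the maximum with
    \<open>1\<close> then provides the one sample that is needed.\<close>
  define S where "S = max 1 (nat \<lceil>4 * (real (card J) - 1) / \<xi>\<^sup>2\<rceil>)"
  have "4 * (real (card J) - 1) / \<xi>\<^sup>2 \<le> real S"
    unfolding S_def by (rule order_trans[OF real_nat_ceiling_ge]) simp
  then have "4 * (real (card J) - 1) \<le> real S * \<xi>\<^sup>2" using assms(5) by (simp add: divide_simps)
  then have "4 * (real (card J) - 1) * A\<^sup>2 \<le> real S * \<xi>\<^sup>2 * A\<^sup>2" by (intro mult_right_mono) auto
  with var have "4 * measure_pmf.expectation ?K (\<lambda>y. (y - A)\<^sup>2) \<le> real S * (\<xi> * A)\<^sup>2"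
    by (simp add: power_mult_distrib algebra_simps)
  then have "measure_pmf.prob (median_of_means S (nat \<lceil>12 * ln (1 / \<delta>)\<rceil>) ?K) {y. \<bar>y - A\<bar> \<ge> \<xi> * A} \<le> \<delta>"
    using assms Apos by (intro median_of_means_deviation fin E1) (auto simp: S_def)
  moreover have "klm_estimator D J Z P \<xi> \<delta> = median_of_means S (nat \<lceil>12 * ln (1 / \<delta>)\<rceil>) ?K"
    using False by (simp add: klm_estimator_def S_def)
  moreover have "measure_pmf.prob q {y. \<bar>y - A\<bar> > \<xi> * A} \<le> measure_pmf.prob q {y. \<bar>y - A\<bar> \<ge> \<xi> * A}"
    for q :: "real pmf"
    by (intro measure_pmf.finite_measure_mono) auto
  ultimately show ?thesis by (metis order_trans)
qed

section \<open>Reliability networks\<close>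

lemma prob_pair_pmf_finite:
  assumes "finite (set_pmf p)" "finite (set_pmf q)"
  shows "measure_pmf.prob (pair_pmf p q) X =
    measure_pmf.expectation p (\<lambda>a. measure_pmf.prob q {b. (a, b) \<in> X})"
proof -
  have "measure_pmf.prob (pair_pmf p q) X = measure_pmf.expectation (pair_pmf p q) (indicator X)"
    by simp
  also have "\<dots> = measure_pmf.expectation p (\<lambda>a. measure_pmf.expectation q (\<lambda>b. indicator X (a, b)))"
    by (rule expectation_pair_pmf_finite[OF assms])
  also have "(\<lambda>a. measure_pmf.expectation q (\<lambda>b. indicator X (a, b))) =
      (\<lambda>a. measure_pmf.prob q {b. (a, b) \<in> X})"
  proof
    fix a
    have "(\<lambda>b. indicator X (a, b) :: real) = indicator {b. (a, b) \<in> X}"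
      by (auto simp: indicator_def)
    then show "measure_pmf.expectation q (\<lambda>b. indicator X (a, b)) = measure_pmf.prob q {b. (a, b) \<in> X}"
      by simp
  qed
  finally show ?thesis .
qed

lemma prob_UN_le_prob_UN_subset:
  assumes "finite K"
  shows "measure_pmf.prob D (\<Union>j\<in>K. Z j) \<le>
    measure_pmf.prob D (\<Union>j\<in>J. Z j) + (\<Sum>j\<in>K - J. measure_pmf.prob D (Z j))"
proof -
  have "measure_pmf.prob D (\<Union>j\<in>K. Z j) \<le>
      measure_pmf.prob D ((\<Union>j\<in>J. Z j) \<union> (\<Union>j\<in>K - J. Z j))"
    by (intro measure_pmf.finite_measure_mono) auto
  also have "\<dots> \<le> measure_pmf.prob D (\<Union>j\<in>J. Z j) + measure_pmf.prob D (\<Union>j\<in>K - J. Z j)"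
    by (intro measure_Un_le) auto
  also have "measure_pmf.prob D (\<Union>j\<in>K - J. Z j) \<le> (\<Sum>j\<in>K - J. measure_pmf.prob D (Z j))"
    using assms by (intro measure_pmf.finite_measure_subadditive_finite) auto
  finally show ?thesis by simp
qed

section \<open>Standing assumptions, positivity of the rates, and cutsets\<close>

locale repairable_network =
  fixes \<Psi> :: "'v rel_system"
  assumes system: "reliability_system \<Psi>"
    and fast_repair: "min_repair_rate \<Psi> / max_fail_rate \<Psi> > real (comps \<Psi>) - 1"
    and several_cutsets: "card (cutsets \<Psi>) > 1"
begin

declare One_nat_def [simp del]

abbreviation "E \<equiv> {1..comps \<Psi>}"
abbreviation "\<mu> \<equiv> total_repair_rate \<Psi>"

lemma rates_pos:
  assumes "i \<in> E"
  shows "fail_rate \<Psi> i > 0" "repair_rate \<Psi> i > 0"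
    "unavail \<Psi> i > 0" "unavail \<Psi> i < 1" "weight \<Psi> i > 0"
proof -
  show "fail_rate \<Psi> i > 0" "repair_rate \<Psi> i > 0"
    using system assms by (auto simp: reliability_system_def)
  then show *: "unavail \<Psi> i > 0" "unavail \<Psi> i < 1" by (auto simp: unavail_def)
  then show "weight \<Psi> i > 0" by (simp add: weight_def)
qed

lemma finite_cutsets: "finite (cutsets \<Psi>)"
  by (rule finite_subset[of _ "Pow E"]) (auto simp: cutsets_def)

lemma cutset_subset: "C \<in> cutsets \<Psi> \<Longrightarrow> C \<subseteq> E"
  and cutset_failed: "C \<in> cutsets \<Psi> \<Longrightarrow> failed \<Psi> C"
  and cutset_minimal: "C \<in> cutsets \<Psi> \<Longrightarrow> failed \<Psi> D \<Longrightarrow> D \<subseteq> C \<Longrightarrow> D = C"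
  by (auto simp: cutsets_def)

lemma finite_cutset: "C \<in> cutsets \<Psi> \<Longrightarrow> finite C"
  using cutset_subset finite_subset by blast

lemma ex_other_cutset: "\<exists>D\<in>cutsets \<Psi>. D \<noteq> C"
proof (rule ccontr)
  assume "\<not> ?thesis"
  then have "cutsets \<Psi> \<subseteq> {C}" by auto
  then have "card (cutsets \<Psi>) \<le> card {C}" by (intro card_mono) auto
  then show False using several_cutsets by simp
qed

text \<open>A second cutset rules out both extremes by minimality: the empty set would lie inside
  it, and \<open>E\<close> would contain it. Properness later keeps every \<open>Z_prob\<close>
  positive.\<close>

lemma cutset_proper:
  assumes "C \<in> cutsets \<Psi>"
  shows "C \<noteq> {}" "C \<noteq> E"
proof -
  obtain D where D: "D \<in> cutsets \<Psi>" "D \<noteq> C" using ex_other_cutset by blast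
  show "C \<noteq> {}" using cutset_minimal[OF D(1) cutset_failed[OF assms]] D(2) by auto
  show "C \<noteq> E" using cutset_minimal[OF assms cutset_failed[OF D(1)]] cutset_subset[OF D(1)] D(2) by auto
qed

lemma failed_iff_cutset: "I \<subseteq> E \<Longrightarrow> failed \<Psi> I \<longleftrightarrow> (\<exists>C\<in>cutsets \<Psi>. C \<subseteq> I)"
proof
  assume I: "I \<subseteq> E" and "failed \<Psi> I"
  then have "I \<in> {D. D \<subseteq> I \<and> failed \<Psi> D}" by auto
  moreover have "finite {D. D \<subseteq> I \<and> failed \<Psi> D}"
    using finite_subset[OF I] by (auto intro: finite_subset[of _ "Pow I"])
  ultimately obtain C where C: "C \<subseteq> I" "failed \<Psi> C" "\<And>D. D \<subseteq> I \<Longrightarrow> failed \<Psi> D \<Longrightarrow> D \<subseteq> C \<Longrightarrow> C = D"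
    using finite_has_minimal2[of "{D. D \<subseteq> I \<and> failed \<Psi> D}" I] by auto
  then have "C \<in> cutsets \<Psi>" using I unfolding cutsets_def by blast
  with C show "\<exists>C\<in>cutsets \<Psi>. C \<subseteq> I" by blast
qed (auto intro: failed_mono cutset_failed)

lemma comps_pos: "comps \<Psi> \<ge> 1"
proof -
  obtain C where "C \<in> cutsets \<Psi>" using ex_other_cutset by blast
  then have "E \<noteq> {}" using cutset_proper cutset_subset by blast
  then show ?thesis by auto
qed

lemma total_repair_rate_pos: "\<mu> > 0"
  unfolding total_repair_rate_def using rates_pos comps_pos by (intro sum_pos) auto

lemma cutset_repair_rate_less:
  assumes "C \<in> cutsets \<Psi>"
  shows "(\<Sum>i\<in>C. repair_rate \<Psi> i) < \<mu>"
proof -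
  have sub: "C \<subseteq> E" using cutset_subset[OF assms] .
  obtain k where k: "k \<in> E - C" using cutset_proper[OF assms] sub by blast
  show ?thesis unfolding total_repair_rate_def
    using k sub rates_pos by (intro sum_strict_mono2[where b = k]) (auto intro: less_imp_le)
qed

lemma set_prob_eq_exp:
  assumes "C \<subseteq> E"
  shows "set_prob \<Psi> C = exp (- set_weight \<Psi> C)"
proof -
  have "set_prob \<Psi> C = (\<Prod>i\<in>C. exp (- weight \<Psi> i))"
    unfolding set_prob_def weight_def using rates_pos assms by (intro prod.cong) auto
  also have "\<dots> = exp (- set_weight \<Psi> C)"
    using finite_subset[OF assms] by (simp add: set_weight_def exp_sum[symmetric] sum_negf)
  finally show ?thesis .
qed

lemma min_weight_le: "C \<in> cutsets \<Psi> \<Longrightarrow> min_weight \<Psi> \<le> set_weight \<Psi> C"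
  unfolding min_weight_def using finite_cutsets by auto

lemma set_weight_mono: "A \<subseteq> B \<Longrightarrow> B \<subseteq> E \<Longrightarrow> set_weight \<Psi> A \<le> set_weight \<Psi> B"
  unfolding set_weight_def
  by (intro sum_mono2 less_imp_le[OF rates_pos(5)]) (auto intro: finite_subset)

lemma min_weight_pos: "min_weight \<Psi> > 0"
proof -
  have "min_weight \<Psi> \<in> set_weight \<Psi> ` cutsets \<Psi>"
    unfolding min_weight_def using finite_cutsets ex_other_cutset by (intro Min_in) auto
  then obtain C where C: "C \<in> cutsets \<Psi>" "min_weight \<Psi> = set_weight \<Psi> C" by auto
  show ?thesis unfolding C(2) set_weight_def
    using cutset_proper[OF C(1)] cutset_subset[OF C(1)] finite_cutset[OF C(1)]
    by (intro sum_pos rates_pos(5)) blast+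
qed

subsection \<open>Cutsets as edge cuts\<close>

lemma card_nodes_ge_2: "card (nodes \<Psi>) \<ge> 2"
proof -
  obtain C where "C \<in> cutsets \<Psi>" using ex_other_cutset by blast
  then obtain u v where uv: "u \<in> nodes \<Psi>" "v \<in> nodes \<Psi>" "(u, v) \<notin> (links \<Psi> (E - C))\<^sup>*"
    using cutset_failed unfolding failed_def connected_by_def by blast
  then have "u \<noteq> v" by auto
  then have "card {u, v} = 2" by simp
  moreover have "finite (nodes \<Psi>)" using system by (simp add: reliability_system_def)
  ultimately show ?thesis using uv card_mono[of "nodes \<Psi>" "{u, v}"] by auto
qed

text \<open>Orients each unordered pair \<open>ends \<Psi> i\<close> arbitrarily so that
  \<open>edge_cut\<close> applies.\<close>

definition endpoints_of :: "(nat \<Rightarrow> 'v) \<Rightarrow> (nat \<Rightarrow> 'v) \<Rightarrow> bool" where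
  "endpoints_of f g \<longleftrightarrow> (\<forall>i\<in>E. f i \<in> nodes \<Psi> \<and> g i \<in> nodes \<Psi> \<and> ends \<Psi> i = {f i, g i})"

lemma ex_endpoints_of: "\<exists>f g. endpoints_of f g"
proof -
  have "\<forall>i\<in>E. \<exists>u v. u \<in> nodes \<Psi> \<and> v \<in> nodes \<Psi> \<and> ends \<Psi> i = {u, v}"
    using system unfolding reliability_system_def by blast
  then show ?thesis unfolding endpoints_of_def by metis
qed

text \<open>No surviving component leaves \<open>S\<close>, so paths that start in \<open>S\<close>
  stay there.\<close>

lemma edge_cut_failed:
  assumes fg: "endpoints_of f g" and S: "S \<subseteq> nodes \<Psi>" "S \<noteq> {}" "S \<noteq> nodes \<Psi>"
  shows "failed \<Psi> (edge_cut f g E S)"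
proof -
  obtain u v where uv: "u \<in> S" "v \<in> nodes \<Psi> - S" using S by blast
  let ?R = "links \<Psi> (E - edge_cut f g E S)"
  have "y \<in> S" if "(u, y) \<in> ?R\<^sup>*" for y
    using that
  proof (induction rule: rtrancl_induct)
    case (step y z)
    then obtain i where i: "i \<in> E" "i \<notin> edge_cut f g E S" "ends \<Psi> i = {y, z}"
      by (auto simp: links_def)
    then have "{f i, g i} = {y, z}" using fg by (auto simp: endpoints_of_def)
    moreover have "f i \<in> S \<longleftrightarrow> g i \<in> S" using i by (auto simp: edge_cut_def)
    ultimately show ?case using step.IH by (metis doubleton_eq_iff)
  qed (use uv in auto)
  then show ?thesis using uv S unfolding failed_def connected_by_def by blast
qed

text \<open>Let \<open>S\<close> be the set of nodes still reachable from one node of a disconnected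
  pair. Its boundary lies in \<open>C\<close> and already makes the system fail, so minimality
  forces equality.\<close>

lemma cutset_eq_edge_cut:
  assumes fg: "endpoints_of f g" and C: "C \<in> cutsets \<Psi>"
  shows "\<exists>S. S \<subseteq> nodes \<Psi> \<and> S \<noteq> {} \<and> S \<noteq> nodes \<Psi> \<and> C = edge_cut f g E S"
proof -
  obtain u v where uv: "u \<in> nodes \<Psi>" "v \<in> nodes \<Psi>" "(u, v) \<notin> (links \<Psi> (E - C))\<^sup>*"
    using cutset_failed[OF C] unfolding failed_def connected_by_def by blast
  define S where "S = {x\<in>nodes \<Psi>. (u, x) \<in> (links \<Psi> (E - C))\<^sup>*}"
  have S: "S \<subseteq> nodes \<Psi>" "S \<noteq> {}" "S \<noteq> nodes \<Psi>" using uv by (auto simp: S_def)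
  have "edge_cut f g E S \<subseteq> C"
  proof
    fix i assume i: "i \<in> edge_cut f g E S"
    show "i \<in> C"
    proof (rule ccontr)
      assume "i \<notin> C"
      then have "(f i, g i) \<in> links \<Psi> (E - C)" "(g i, f i) \<in> links \<Psi> (E - C)"
        using i fg by (auto simp: links_def edge_cut_def endpoints_of_def)
      then have "f i \<in> S \<longleftrightarrow> g i \<in> S"
        using i fg unfolding S_def edge_cut_def endpoints_of_def
        by (auto intro: rtrancl_into_rtrancl)
      then show False using i by (auto simp: edge_cut_def)
    qed
  qed
  then have "edge_cut f g E S = C"
    by (rule cutset_minimal[OF C edge_cut_failed[OF fg S]])
  then show ?thesis using S by blast
qed

text \<open>Karger's bound with \<open>\<alpha> = t / min_weight \<Psi>\<close>, written as an
  exponential in \<open>t\<close> for later integration. Below the minimum weight there is nothing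
  to count, so every real \<open>t\<close> is covered.\<close>

lemma card_light_cutsets_le:
  "real (card {C\<in>cutsets \<Psi>. set_weight \<Psi> C \<le> t}) \<le>
    exp (2 * ln (real (card (nodes \<Psi>))) / min_weight \<Psi> * t)"
proof (cases "t < min_weight \<Psi>")
  case True
  then have "{C\<in>cutsets \<Psi>. set_weight \<Psi> C \<le> t} = {}" using min_weight_le by fastforce
  then show ?thesis by (simp only:) simp
next
  case False
  obtain f g where fg: "endpoints_of f g" using ex_endpoints_of by blast
  let ?n = "real (card (nodes \<Psi>))"
  define \<alpha> where "\<alpha> = t / min_weight \<Psi>"
  have \<alpha>: "\<alpha> \<ge> 1" "\<alpha> * min_weight \<Psi> = t" using False min_weight_pos by (auto simp: \<alpha>_def)
  have fin: "finite (nodes \<Psi>)" using system by (simp add: reliability_system_def)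
  have "{C\<in>cutsets \<Psi>. set_weight \<Psi> C \<le> t} \<subseteq> small_cuts (nodes \<Psi>) E f g (weight \<Psi>) (\<alpha> * min_weight \<Psi>)"
    using cutset_eq_edge_cut[OF fg] unfolding small_cuts_def \<alpha>(2) set_weight_def by blast
  moreover have "finite (small_cuts (nodes \<Psi>) E f g (weight \<Psi>) (\<alpha> * min_weight \<Psi>))"
    unfolding small_cuts_def using fin by (intro finite_imageI) auto
  ultimately have "card {C\<in>cutsets \<Psi>. set_weight \<Psi> C \<le> t} \<le>
      card (small_cuts (nodes \<Psi>) E f g (weight \<Psi>) (\<alpha> * min_weight \<Psi>))"
    by (rule card_mono[rotated])
  also have "real \<dots> \<le> ?n powr (2 * \<alpha>)"
  proof (rule card_small_cuts_le)
    show "f ` E \<subseteq> nodes \<Psi>" "g ` E \<subseteq> nodes \<Psi>" using fg by (auto simp: endpoints_of_def)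
    fix S assume S: "S \<subseteq> nodes \<Psi>" "S \<noteq> {}" "S \<noteq> nodes \<Psi>"
    have sub: "edge_cut f g E S \<subseteq> E" by (auto simp: edge_cut_def)
    \<comment> \<open>An edge cut contains a cutset and weights are positive, so it cannot be
      lighter than the lightest cutset.\<close>
    obtain C where C: "C \<in> cutsets \<Psi>" "C \<subseteq> edge_cut f g E S"
      using edge_cut_failed[OF fg S] failed_iff_cutset[OF sub] by blast
    show "min_weight \<Psi> \<le> sum (weight \<Psi>) (edge_cut f g E S)"
      using order_trans[OF min_weight_le[OF C(1)] set_weight_mono[OF C(2) sub]]
      by (simp add: set_weight_def)
  qed (use \<alpha> min_weight_pos fin card_nodes_ge_2 rates_pos(5) in \<open>auto intro: less_imp_le\<close>)
  also have "\<dots> = exp (2 * ln ?n / min_weight \<Psi> * t)"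
    using card_nodes_ge_2 by (simp add: powr_def \<alpha>_def field_simps)
  finally show ?thesis by simp
qed

text \<open>Since \<open>set_prob\<close> is the exponential of minus the weight, this is the tail
  bound fed with the cut count; the hypothesis says \<open>\<kappa> < 1\<close>.\<close>

lemma sum_set_prob_heavy_cutsets_le:
  assumes "min_weight \<Psi> > 2 * ln (real (card (nodes \<Psi>)))"
  defines "\<kappa> \<equiv> 2 * ln (real (card (nodes \<Psi>))) / min_weight \<Psi>"
  shows "(\<Sum>C\<in>cutsets \<Psi> - approx_min_cutsets \<Psi> \<alpha>. set_prob \<Psi> C) \<le>
    exp (- (1 - \<kappa>) * (\<alpha> * min_weight \<Psi>)) / (1 - \<kappa>)"
proof -
  have "(\<Sum>C\<in>cutsets \<Psi> - approx_min_cutsets \<Psi> \<alpha>. set_prob \<Psi> C) =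
      (\<Sum>C | C \<in> cutsets \<Psi> \<and> set_weight \<Psi> C > \<alpha> * min_weight \<Psi>. exp (- set_weight \<Psi> C))"
    by (rule sum.cong) (auto simp: approx_min_cutsets_def intro!: set_prob_eq_exp cutset_subset)
  also have "\<dots> \<le> exp (- (1 - \<kappa>) * (\<alpha> * min_weight \<Psi>)) / (1 - \<kappa>)"
  proof (rule sum_exp_minus_tail_le[OF finite_cutsets])
    show "\<kappa> < 1" using assms min_weight_pos by (simp add: divide_simps)
  qed (unfold \<kappa>_def, rule card_light_cutsets_le)
  finally show ?thesis .
qed

subsection \<open>Probabilities of failure events\<close>

lemma finite_set_component_pmf: "finite (set_pmf (component_pmf \<Psi>))"
  unfolding component_pmf_def by (intro finite_set_Pi_pmf) auto

text \<open>Assignments in the support take the default \<open>False\<close> outside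
  \<open>E\<close> and so correspond to the states \<open>I \<subseteq> E\<close>.\<close>

lemma expectation_component_pmf:
  fixes h :: "nat set \<Rightarrow> real"
  shows "measure_pmf.expectation (component_pmf \<Psi>) (\<lambda>x. h {i\<in>E. x i}) =
    (\<Sum>I\<in>Pow E. state_prob \<Psi> I * h I)"
proof -
  let ?ind = "\<lambda>I i. i \<in> (I :: nat set)"
  have inj: "inj_on ?ind (Pow E)" by (auto simp: inj_on_def fun_eq_iff)
  have sp: "pmf (component_pmf \<Psi>) (?ind I) = state_prob \<Psi> I" if "I \<in> Pow E" for I
  proof -
    have "pmf (component_pmf \<Psi>) (?ind I) = (\<Prod>i\<in>E. pmf (bernoulli_pmf (unavail \<Psi> i)) (i \<in> I))"
      unfolding component_pmf_def using that by (intro pmf_Pi') auto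
    also have "\<dots> = (\<Prod>i\<in>E. if i \<in> I then unavail \<Psi> i else 1 - unavail \<Psi> i)"
      using rates_pos by (intro prod.cong) (auto simp: less_imp_le)
    also have "\<dots> = state_prob \<Psi> I"
    proof -
      have "E \<inter> {i. i \<in> I} = I" "E \<inter> - {i. i \<in> I} = E - I" using that by auto
      then show ?thesis by (simp add: prod.If_cases state_prob_def)
    qed
    finally show ?thesis .
  qed
  have "measure_pmf.expectation (component_pmf \<Psi>) (\<lambda>x. h {i\<in>E. x i}) =
      (\<Sum>x\<in>?ind ` Pow E. pmf (component_pmf \<Psi>) x *\<^sub>R h {i\<in>E. x i})"
  proof (rule integral_measure_pmf)
    fix x assume "x \<in> set_pmf (component_pmf \<Psi>)"
    then have "x i = False" if "i \<notin> E" for i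
      using that set_Pi_pmf_subset[of E False] unfolding component_pmf_def by blast
    then have "x = ?ind {i\<in>E. x i}" by (auto simp: fun_eq_iff)
    then show "x \<in> ?ind ` Pow E" by (rule image_eqI) auto
  qed simp
  also have "\<dots> = (\<Sum>I\<in>Pow E. state_prob \<Psi> I * h I)"
  proof (subst sum.reindex[OF inj], rule sum.cong[OF refl])
    fix I assume I: "I \<in> Pow E"
    then have "{i\<in>E. i \<in> I} = I" by blast
    then show "((\<lambda>x. pmf (component_pmf \<Psi>) x *\<^sub>R h {i\<in>E. x i}) \<circ> ?ind) I = state_prob \<Psi> I * h I"
      using sp[OF I] by simp
  qed
  finally show ?thesis .
qed

abbreviation "repair_pmf \<equiv> weighted_pmf E (repair_rate \<Psi>)"

lemma pmf_repair: "pmf repair_pmf k = (if k \<in> E then repair_rate \<Psi> k / \<mu> else 0)"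
  using pmf_weighted_pmf[of E "repair_rate \<Psi>" k] total_repair_rate_pos rates_pos(2)
  by (auto simp: total_repair_rate_def less_imp_le)

lemma set_repair_pmf: "set_pmf repair_pmf \<subseteq> E"
  by (auto simp: set_pmf_iff pmf_repair split: if_splits)

lemma finite_set_repair_pmf: "finite (set_pmf repair_pmf)"
  using set_repair_pmf finite_subset by blast

lemma finite_set_assignment_pmf: "finite (set_pmf (assignment_pmf \<Psi>))"
  unfolding assignment_pmf_def
  using finite_set_component_pmf finite_set_repair_pmf by simp

lemma prob_repair_pmf:
  "measure_pmf.prob repair_pmf K = (\<Sum>k\<in>E. if k \<in> K then repair_rate \<Psi> k / \<mu> else 0)"
proof -
  have "measure_pmf.prob repair_pmf K = measure_pmf.prob repair_pmf {k\<in>E. k \<in> K}"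
    by (rule measure_prob_cong_0) (auto simp: pmf_repair)
  also have "\<dots> = (\<Sum>k\<in>{k\<in>E. k \<in> K}. repair_rate \<Psi> k / \<mu>)"
    by (subst measure_measure_pmf_finite) (auto simp: pmf_repair)
  finally show ?thesis by (simp only: sum.inter_filter finite_atLeastAtMost)
qed

lemma prob_assignment_pmf:
  "measure_pmf.prob (assignment_pmf \<Psi>) X =
    measure_pmf.expectation (component_pmf \<Psi>)
      (\<lambda>x. measure_pmf.prob repair_pmf {k. (x, \<lambda>i. i \<noteq> k) \<in> X})"
  unfolding assignment_pmf_def measure_map_pmf
    prob_pair_pmf_finite[OF finite_set_component_pmf finite_set_repair_pmf]
  by (simp add: vimage_def)

lemma prob_all_unavailable:
  assumes "C \<subseteq> E"
  shows "measure_pmf.prob (component_pmf \<Psi>) {x. \<forall>i\<in>C. x i} = set_prob \<Psi> C"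
proof -
  define B where "B i = (if i \<in> C then {True} else UNIV)" for i
  have "{x. \<forall>i\<in>C. x i} = Pi E B" using assms by (auto simp: B_def Pi_def split: if_splits)
  then have "measure_pmf.prob (component_pmf \<Psi>) {x. \<forall>i\<in>C. x i} =
      (\<Prod>i\<in>E. measure_pmf.prob (bernoulli_pmf (unavail \<Psi> i)) (B i))"
    unfolding component_pmf_def by (simp only: measure_Pi_pmf_Pi finite_atLeastAtMost)
  also have "\<dots> = (\<Prod>i\<in>E. if i \<in> C then unavail \<Psi> i else 1)"
    using rates_pos by (intro prod.cong) (auto simp: B_def measure_pmf_single less_imp_le)
  also have "\<dots> = set_prob \<Psi> C"
    using assms by (simp add: prod.If_cases set_prob_def Int_absorb1)
  finally show ?thesis .
qed

lemma prob_X_clause: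
  assumes "C \<subseteq> E"
  shows "measure_pmf.prob (assignment_pmf \<Psi>) (X_clause C) = X_prob \<Psi> C"
proof -
  have "measure_pmf.prob repair_pmf {k. (x, \<lambda>i. i \<noteq> k) \<in> X_clause C} = indicator {x. \<forall>i\<in>C. x i} x" for x
    by (cases "\<forall>i\<in>C. x i") (auto simp: X_clause_def)
  then show ?thesis
    unfolding prob_assignment_pmf using prob_all_unavailable[OF assms] by (simp add: X_prob_def)
qed

lemma prob_Z_clause:
  assumes "C \<subseteq> E"
  shows "measure_pmf.prob (assignment_pmf \<Psi>) (Z_clause C) = Z_prob \<Psi> C"
proof -
  have fin: "finite C" using assms finite_subset by blast
  have "measure_pmf.prob repair_pmf (- C) = 1 - measure_pmf.prob repair_pmf C"
    using measure_pmf.prob_compl[of C repair_pmf] by (simp add: Compl_eq_Diff_UNIV)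
  also have "measure_pmf.prob repair_pmf C = (\<Sum>i\<in>C. repair_rate \<Psi> i / \<mu>)"
    using fin assms by (subst measure_measure_pmf_finite) (auto simp: pmf_repair intro!: sum.cong)
  finally have R: "measure_pmf.prob repair_pmf (- C) = 1 - (\<Sum>i\<in>C. repair_rate \<Psi> i / \<mu>)" .
  have "measure_pmf.prob repair_pmf {k. (x, \<lambda>i. i \<noteq> k) \<in> Z_clause C} =
      indicator {x. \<forall>i\<in>C. x i} x * measure_pmf.prob repair_pmf (- C)" for x
  proof (cases "\<forall>i\<in>C. x i")
    case True
    then have "{k. (x, \<lambda>i. i \<noteq> k) \<in> Z_clause C} = - C" by (auto simp: Z_clause_def)
    then show ?thesis using True by simp
  next
    case False
    then have "{k. (x, \<lambda>i. i \<noteq> k) \<in> Z_clause C} = {}" by (auto simp: Z_clause_def)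
    then show ?thesis using False by simp
  qed
  then show ?thesis
    unfolding prob_assignment_pmf using prob_all_unavailable[OF assms] R by (simp add: Z_prob_def)
qed

text \<open>The system unavailability, written as a union of clauses because that is what the
  estimator targets; \<open>P_fail_eq\<close> recovers the sum over states.\<close>

definition P_fail :: real where
  "P_fail = measure_pmf.prob (assignment_pmf \<Psi>) (\<Union>C\<in>cutsets \<Psi>. X_clause C)"

text \<open>The probability that the system stays failed after repair of the random component \<open>I\<close>.\<close>

definition P_stay :: real where
  "P_stay = measure_pmf.prob (assignment_pmf \<Psi>) (\<Union>C\<in>cutsets \<Psi>. Z_clause C)"

lemma P_fail_eq: "P_fail = (\<Sum>I\<in>Pow E. state_prob \<Psi> I * (if failed \<Psi> I then 1 else 0))"
proof -
  have "measure_pmf.prob repair_pmf {k. (x, \<lambda>i. i \<noteq> k) \<in> (\<Union>C\<in>cutsets \<Psi>. X_clause C)} =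
      (if failed \<Psi> {i\<in>E. x i} then 1 else 0)" for x
  proof -
    have "failed \<Psi> {i\<in>E. x i} \<longleftrightarrow> (\<exists>C\<in>cutsets \<Psi>. \<forall>i\<in>C. x i)"
      using failed_iff_cutset[of "{i\<in>E. x i}"] cutset_subset by blast
    then show ?thesis by (auto simp: X_clause_def)
  qed
  then show ?thesis
    unfolding P_fail_def prob_assignment_pmf
    by (simp only: expectation_component_pmf[of "\<lambda>I. if failed \<Psi> I then 1 else 0"])
qed

text \<open>In state \<open>I\<close> with \<open>k\<close> repaired, some \<open>Z_clause\<close>
  of a cutset holds iff a cutset fits into \<open>I - {k}\<close>, that is, iff the repaired state
  is still failed.\<close>

lemma P_stay_eq:
  "P_stay = (\<Sum>I\<in>Pow E. state_prob \<Psi> I *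
     (\<Sum>k\<in>E. if failed \<Psi> (I - {k}) then repair_rate \<Psi> k / \<mu> else 0))"
proof -
  have "measure_pmf.prob repair_pmf {k. (x, \<lambda>i. i \<noteq> k) \<in> (\<Union>C\<in>cutsets \<Psi>. Z_clause C)} =
      (\<Sum>k\<in>E. if failed \<Psi> ({i\<in>E. x i} - {k}) then repair_rate \<Psi> k / \<mu> else 0)" for x
  proof -
    have fl: "failed \<Psi> ({i\<in>E. x i} - {k}) \<longleftrightarrow> (\<exists>C\<in>cutsets \<Psi>. (\<forall>i\<in>C. x i) \<and> k \<notin> C)" for k
    proof -
      have "failed \<Psi> ({i\<in>E. x i} - {k}) \<longleftrightarrow> (\<exists>C\<in>cutsets \<Psi>. C \<subseteq> {i\<in>E. x i} - {k})"
        by (rule failed_iff_cutset) auto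
      also have "\<dots> \<longleftrightarrow> (\<exists>C\<in>cutsets \<Psi>. (\<forall>i\<in>C. x i) \<and> k \<notin> C)"
      proof (rule bex_cong[OF refl])
        fix C assume "C \<in> cutsets \<Psi>"
        from cutset_subset[OF this]
        show "C \<subseteq> {i\<in>E. x i} - {k} \<longleftrightarrow> (\<forall>i\<in>C. x i) \<and> k \<notin> C" by blast
      qed
      finally show ?thesis .
    qed
    have "(x, \<lambda>i. i \<noteq> k) \<in> Z_clause C \<longleftrightarrow> (\<forall>i\<in>C. x i) \<and> k \<notin> C" for k C
      by (auto simp: Z_clause_def)
    then have "{k. (x, \<lambda>i. i \<noteq> k) \<in> (\<Union>C\<in>cutsets \<Psi>. Z_clause C)} =
        {k. failed \<Psi> ({i\<in>E. x i} - {k})}"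
      by (simp only: UN_iff fl)
    then show ?thesis by (simp only: prob_repair_pmf mem_Collect_eq)
  qed
  then show ?thesis
    unfolding P_stay_def prob_assignment_pmf
    by (simp only: expectation_component_pmf[of
          "\<lambda>I. \<Sum>k\<in>E. if failed \<Psi> (I - {k}) then repair_rate \<Psi> k / \<mu> else 0"])
qed

text \<open>\<open>P_fail - P_stay\<close> is the chance that the random repair ends a failure.
  Multiplied by \<open>\<mu>\<close> it is the rate of restoring transitions, which detailed balance
  turns one by one into failing transitions.\<close>

lemma failure_frequency_eq: "failure_frequency \<Psi> = (P_fail - P_stay) * \<mu>"
proof -
  let ?up = "{I. I \<subseteq> E \<and> \<not> failed \<Psi> I}"
  let ?A = "{x \<in> Pow E \<times> E. failed \<Psi> (fst x) \<and> \<not> failed \<Psi> (fst x - {snd x})}"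
  let ?D = "SIGMA I : ?up. {i\<in>E - I. failed \<Psi> (insert i I)}"
  have \<mu>: "\<mu> = (\<Sum>k\<in>E. repair_rate \<Psi> k)" by (simp add: total_repair_rate_def)
  have in_state: "k \<in> I" if "failed \<Psi> I" "\<not> failed \<Psi> (I - {k})" for I k
    using that by (cases "k \<in> I") auto
  have fin: "finite ?up" by (rule finite_subset[of _ "Pow E"]) auto
  have "(P_fail - P_stay) * \<mu> =
      (\<Sum>I\<in>Pow E. \<Sum>k\<in>E. if failed \<Psi> I \<and> \<not> failed \<Psi> (I - {k}) then state_prob \<Psi> I * repair_rate \<Psi> k else 0)"
    unfolding P_fail_eq P_stay_eq sum_subtractf[symmetric] sum_distrib_right
  proof (rule sum.cong[OF refl])
    fix I
    let ?g = "\<lambda>k. if failed \<Psi> (I - {k}) then repair_rate \<Psi> k else 0"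
    have "(\<Sum>k\<in>E. if failed \<Psi> (I - {k}) then repair_rate \<Psi> k / \<mu> else 0) * \<mu> = sum ?g E"
      unfolding sum_distrib_right using total_repair_rate_pos by (intro sum.cong) auto
    moreover have "(if failed \<Psi> I then 1 else 0) * \<mu> = (\<Sum>k\<in>E. if failed \<Psi> I then repair_rate \<Psi> k else 0)"
      by (simp add: \<mu>)
    ultimately have "(state_prob \<Psi> I * (if failed \<Psi> I then 1 else 0) - state_prob \<Psi> I *
        (\<Sum>k\<in>E. if failed \<Psi> (I - {k}) then repair_rate \<Psi> k / \<mu> else 0)) * \<mu> =
        state_prob \<Psi> I * ((\<Sum>k\<in>E. if failed \<Psi> I then repair_rate \<Psi> k else 0) - sum ?g E)"
      by (simp only: left_diff_distrib right_diff_distrib mult.assoc)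
    also have "\<dots> = (\<Sum>k\<in>E. state_prob \<Psi> I * ((if failed \<Psi> I then repair_rate \<Psi> k else 0) - ?g k))"
      by (simp only: sum_subtractf[symmetric] sum_distrib_left)
    also have "\<dots> = (\<Sum>k\<in>E. if failed \<Psi> I \<and> \<not> failed \<Psi> (I - {k}) then state_prob \<Psi> I * repair_rate \<Psi> k else 0)"
      by (rule sum.cong) (auto dest: failed_mono[of \<Psi> "I - {_}" I])
    finally show "(state_prob \<Psi> I * (if failed \<Psi> I then 1 else 0) - state_prob \<Psi> I *
        (\<Sum>k\<in>E. if failed \<Psi> (I - {k}) then repair_rate \<Psi> k / \<mu> else 0)) * \<mu> =
        (\<Sum>k\<in>E. if failed \<Psi> I \<and> \<not> failed \<Psi> (I - {k}) then state_prob \<Psi> I * repair_rate \<Psi> k else 0)" .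
  qed
  also have "\<dots> = (\<Sum>x\<in>Pow E \<times> E. if failed \<Psi> (fst x) \<and> \<not> failed \<Psi> (fst x - {snd x})
      then state_prob \<Psi> (fst x) * repair_rate \<Psi> (snd x) else 0)"
    by (simp add: sum.cartesian_product case_prod_unfold)
  also have "\<dots> = (\<Sum>x\<in>?A. state_prob \<Psi> (fst x) * repair_rate \<Psi> (snd x))"
    by (subst sum.inter_filter) auto
  also have "\<dots> = (\<Sum>x\<in>?D. state_prob \<Psi> (fst x) * fail_rate \<Psi> (snd x))"
  \<comment> \<open>The repair of \<open>k\<close> in \<open>I\<close> is matched with the failure
    of \<open>k\<close> in \<open>I - {k}\<close>.\<close>
  proof (rule sum.reindex_bij_witness[where i = "\<lambda>(I, i). (insert i I, i)" and j = "\<lambda>(I, i). (I - {i}, i)"],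
      goal_cases)
    case (1 a)
    then show ?case using in_state[of "fst a" "snd a"] by (auto simp: insert_absorb)
  next
    case (2 a)
    then show ?case using in_state[of "fst a" "snd a"] by (auto simp: insert_absorb)
  next
    case (5 a)
    obtain I k where a: "a = (I, k)" by (cases a)
    with 5 have "k \<in> I" using in_state by auto
    with 5 a have *: "I - {k} \<subseteq> E" "k \<in> E - (I - {k})" "k \<in> I" by auto
    then show ?case using detailed_balance[OF system *(1,2)] by (simp add: a insert_absorb)
  qed auto
  also have "\<dots> = failure_frequency \<Psi>"
    unfolding failure_frequency_eq_transition_rate[OF system] sum_distrib_left
    using fin by (subst sum.Sigma) (auto simp: case_prod_unfold)
  finally show ?thesis by simp
qed

subsection \<open>Bounds on the failure frequency\<close>

text \<open>The quantity \<open>s\<close> of \<open>algorithm_B\<close>: a lower bound on the size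
  of a cutset, which weighs at least \<open>min_weight \<Psi>\<close> while a component weighs at
  most \<open>max_weight \<Psi>\<close>.\<close>

definition size_bound :: real where
  "size_bound = min (max (min_weight \<Psi> / max_weight \<Psi>) 1) (real (comps \<Psi>))"

text \<open>The quantity \<open>\<rho>\<close> of \<open>algorithm_B\<close>: a lower bound of
  \<open>rate_balance\<close> over the failed states.\<close>

definition balance_bound :: real where
  "balance_bound = min_repair_rate \<Psi> * size_bound - max_fail_rate \<Psi> * (real (comps \<Psi>) - size_bound)"

lemma min_repair_rate_le: "i \<in> E \<Longrightarrow> min_repair_rate \<Psi> \<le> repair_rate \<Psi> i"
  and max_fail_rate_ge: "i \<in> E \<Longrightarrow> fail_rate \<Psi> i \<le> max_fail_rate \<Psi>"
  and max_weight_ge: "i \<in> E \<Longrightarrow> weight \<Psi> i \<le> max_weight \<Psi>"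
  unfolding min_repair_rate_def max_fail_rate_def max_weight_def by auto

lemma extremal_rates_pos: "min_repair_rate \<Psi> > 0" "max_fail_rate \<Psi> > 0" "max_weight \<Psi> > 0"
proof -
  have 1: "1 \<in> E" using comps_pos by simp
  have "min_repair_rate \<Psi> \<in> repair_rate \<Psi> ` E"
    unfolding min_repair_rate_def using 1 by (intro Min_in) auto
  then show "min_repair_rate \<Psi> > 0" using rates_pos(2) by auto
  show "max_fail_rate \<Psi> > 0" "max_weight \<Psi> > 0"
    using 1 rates_pos(1,5) max_fail_rate_ge max_weight_ge by (meson less_le_trans)+
qed

lemma size_bound_ge_1: "size_bound \<ge> 1"
  using comps_pos by (auto simp: size_bound_def)

text \<open>The bound increases with \<open>size_bound\<close>, so the worst case is
  \<open>1\<close>, where positivity is the assumption \<open>fast_repair\<close>.\<close>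

lemma balance_bound_pos: "balance_bound > 0"
proof -
  have "min_repair_rate \<Psi> > max_fail_rate \<Psi> * (real (comps \<Psi>) - 1)"
    using fast_repair extremal_rates_pos(2) by (simp add: pos_less_divide_eq mult.commute)
  moreover have "min_repair_rate \<Psi> * 1 \<le> min_repair_rate \<Psi> * size_bound"
    using size_bound_ge_1 extremal_rates_pos(1) by (intro mult_left_mono) auto
  moreover have "max_fail_rate \<Psi> * (real (comps \<Psi>) - size_bound) \<le> max_fail_rate \<Psi> * (real (comps \<Psi>) - 1)"
    using size_bound_ge_1 extremal_rates_pos(2) by (intro mult_left_mono) auto
  ultimately show ?thesis unfolding balance_bound_def by linarith
qed

lemma size_bound_le_card_cutset:
  assumes "C \<in> cutsets \<Psi>"
  shows "size_bound \<le> real (card C)"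
proof -
  have "min_weight \<Psi> \<le> set_weight \<Psi> C" using min_weight_le[OF assms] .
  also have "\<dots> \<le> (\<Sum>i\<in>C. max_weight \<Psi>)"
    unfolding set_weight_def using cutset_subset[OF assms] by (intro sum_mono max_weight_ge) auto
  finally have "min_weight \<Psi> / max_weight \<Psi> \<le> real (card C)"
    using extremal_rates_pos(3) by (simp add: divide_simps)
  moreover have "card C \<ge> 1"
    using finite_cutset[OF assms] cutset_proper(1)[OF assms] by (simp add: Suc_le_eq card_gt_0_iff One_nat_def)
  ultimately show ?thesis unfolding size_bound_def by auto
qed

lemma size_bound_repair_rate_le:
  assumes "C \<in> cutsets \<Psi>"
  shows "size_bound * min_repair_rate \<Psi> \<le> (\<Sum>i\<in>C. repair_rate \<Psi> i)"
proof -
  have "size_bound * min_repair_rate \<Psi> \<le> real (card C) * min_repair_rate \<Psi>"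
    using size_bound_le_card_cutset[OF assms] extremal_rates_pos(1) by (intro mult_right_mono) auto
  also have "\<dots> = (\<Sum>i\<in>C. min_repair_rate \<Psi>)" by simp
  also have "\<dots> \<le> (\<Sum>i\<in>C. repair_rate \<Psi> i)"
    using cutset_subset[OF assms] by (intro sum_mono min_repair_rate_le) auto
  finally show ?thesis .
qed

text \<open>A failed state contains a cutset and thus at least \<open>size_bound\<close> components;
  the extremal rates give the lower bound.\<close>

lemma rate_balance_bounds:
  assumes "I \<subseteq> E" "failed \<Psi> I"
  shows "balance_bound \<le> rate_balance \<Psi> I" "rate_balance \<Psi> I \<le> \<mu>"
proof -
  have fin: "finite I" using assms(1) finite_subset by blast
  obtain C where C: "C \<in> cutsets \<Psi>" "C \<subseteq> I" using failed_iff_cutset assms by blast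
  have s: "size_bound \<le> real (card I)"
    using size_bound_le_card_cutset[OF C(1)] card_mono[OF fin C(2)] by linarith
  have card: "real (card (E - I)) = real (comps \<Psi>) - real (card I)"
    using card_Diff_subset[OF fin assms(1)] card_mono[OF _ assms(1)] by simp
  have "min_repair_rate \<Psi> * size_bound \<le> min_repair_rate \<Psi> * real (card I)"
    using s extremal_rates_pos(1) by (intro mult_left_mono) auto
  also have "\<dots> = (\<Sum>i\<in>I. min_repair_rate \<Psi>)" by simp
  also have "\<dots> \<le> (\<Sum>i\<in>I. repair_rate \<Psi> i)"
    using assms(1) by (intro sum_mono min_repair_rate_le) auto
  finally have 1: "min_repair_rate \<Psi> * size_bound \<le> (\<Sum>i\<in>I. repair_rate \<Psi> i)" .
  have "(\<Sum>i\<in>E - I. fail_rate \<Psi> i) \<le> (\<Sum>i\<in>E - I. max_fail_rate \<Psi>)"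
    by (intro sum_mono max_fail_rate_ge) auto
  also have "\<dots> = max_fail_rate \<Psi> * (real (comps \<Psi>) - real (card I))" by (simp add: card)
  also have "\<dots> \<le> max_fail_rate \<Psi> * (real (comps \<Psi>) - size_bound)"
    using s extremal_rates_pos(2) by (intro mult_left_mono) auto
  finally show "balance_bound \<le> rate_balance \<Psi> I"
    using 1 unfolding balance_bound_def rate_balance_def by linarith
  have "(\<Sum>i\<in>I. repair_rate \<Psi> i) \<le> \<mu>"
    unfolding total_repair_rate_def using assms(1) rates_pos(2)
    by (intro sum_mono2) (auto intro: less_imp_le)
  moreover have "(\<Sum>i\<in>E - I. fail_rate \<Psi> i) \<ge> 0"
    using rates_pos(1) by (intro sum_nonneg) (auto intro: less_imp_le)
  ultimately show "rate_balance \<Psi> I \<le> \<mu>" unfolding rate_balance_def by linarith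
qed

lemma state_prob_nonneg: "I \<subseteq> E \<Longrightarrow> state_prob \<Psi> I \<ge> 0"
  unfolding state_prob_def
  by (intro mult_nonneg_nonneg prod_nonneg) (auto intro!: less_imp_le rates_pos(3,4))

lemma failure_frequency_eq_sum_Pow:
  "failure_frequency \<Psi> = (\<Sum>I\<in>Pow E. state_prob \<Psi> I * (if failed \<Psi> I then rate_balance \<Psi> I else 0))"
proof -
  have "failed_states \<Psi> = {I \<in> Pow E. failed \<Psi> I}" by (auto simp: failed_states_def)
  then have "failure_frequency \<Psi> =
      (\<Sum>I\<in>Pow E. if failed \<Psi> I then state_prob \<Psi> I * rate_balance \<Psi> I else 0)"
    unfolding failure_frequency_def by (simp only: sum.inter_filter finite_Pow_iff finite_atLeastAtMost)
  then show ?thesis by (auto intro!: sum.cong)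
qed

lemma balance_bound_P_fail_le: "balance_bound * P_fail \<le> failure_frequency \<Psi>"
  unfolding P_fail_eq failure_frequency_eq_sum_Pow sum_distrib_left
proof (rule sum_mono)
  fix I assume "I \<in> Pow E"
  then show "balance_bound * (state_prob \<Psi> I * (if failed \<Psi> I then 1 else 0)) \<le>
      state_prob \<Psi> I * (if failed \<Psi> I then rate_balance \<Psi> I else 0)"
    using rate_balance_bounds(1)[of I] state_prob_nonneg[of I]
    by (auto simp: mult.commute intro: mult_right_mono)
qed

lemma set_prob_pos: "C \<subseteq> E \<Longrightarrow> set_prob \<Psi> C > 0"
  by (simp add: set_prob_eq_exp)

lemma Z_prob_pos:
  assumes "C \<in> cutsets \<Psi>"
  shows "Z_prob \<Psi> C > 0"
  unfolding Z_prob_def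
  using set_prob_pos[OF cutset_subset[OF assms]] cutset_repair_rate_less[OF assms] total_repair_rate_pos
  by (intro mult_pos_pos) (auto simp: sum_divide_distrib[symmetric])

lemma set_prob_le_P_fail:
  assumes "C \<in> cutsets \<Psi>"
  shows "set_prob \<Psi> C \<le> P_fail"
proof -
  have "set_prob \<Psi> C = measure_pmf.prob (assignment_pmf \<Psi>) (X_clause C)"
    using prob_X_clause[OF cutset_subset[OF assms]] by (simp add: X_prob_def)
  also have "\<dots> \<le> P_fail"
    unfolding P_fail_def using assms by (intro measure_pmf.finite_measure_mono) auto
  finally show ?thesis .
qed

lemma Z_prob_le_P_stay:
  assumes "C \<in> cutsets \<Psi>"
  shows "Z_prob \<Psi> C \<le> P_stay"
proof -
  have "Z_prob \<Psi> C = measure_pmf.prob (assignment_pmf \<Psi>) (Z_clause C)"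
    using prob_Z_clause[OF cutset_subset[OF assms]] by simp
  also have "\<dots> \<le> P_stay"
    unfolding P_stay_def using assms by (intro measure_pmf.finite_measure_mono) auto
  finally show ?thesis .
qed

lemma P_fail_pos: "P_fail > 0"
  using ex_other_cutset set_prob_pos set_prob_le_P_fail cutset_subset by (meson less_le_trans)

lemma failure_frequency_pos: "failure_frequency \<Psi> > 0"
  using balance_bound_P_fail_le mult_pos_pos[OF balance_bound_pos P_fail_pos] by linarith

text \<open>Provides the strictness needed later: the bad event of an approximation includes
  equality, while the individual errors are bounded only non-strictly.\<close>

lemma P_stay_less_P_fail: "P_stay < P_fail"
  using failure_frequency_pos total_repair_rate_pos
  by (simp add: failure_frequency_eq zero_less_mult_iff)

subsection \<open>Monte Carlo simulation\<close>

text \<open>Samples lie between \<open>0\<close> and \<open>\<mu>\<close>, so their variance is at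
  most \<open>\<mu>\<close> times the failure frequency. The latter is at least
  \<open>set_prob \<Psi> C * balance_bound\<close>, the computable quantity inside
  \<open>S\<close>.\<close>

lemma mcs_deviation:
  assumes "C \<in> cutsets \<Psi>" "\<epsilon> > 0" "0 < \<delta>" "\<delta> < 1"
  defines "S \<equiv> nat \<lceil>\<mu> * (2 + \<epsilon>) * ln 8 / (set_prob \<Psi> C * balance_bound * \<epsilon>\<^sup>2)\<rceil>"
  shows "is_approximation (mcs \<Psi> S (nat \<lceil>12 * ln (1 / \<delta>)\<rceil>)) (failure_frequency \<Psi>) \<epsilon> \<delta>"
proof -
  let ?F = "failure_frequency \<Psi>"
  define b where "b I = (if failed \<Psi> I then rate_balance \<Psi> I else 0)" for I
  have sample: "mcs_sample \<Psi> = map_pmf (\<lambda>x. b {i\<in>E. x i}) (component_pmf \<Psi>)"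
    by (simp add: mcs_sample_def b_def Let_def)
  have fin: "finite (set_pmf (mcs_sample \<Psi>))"
    unfolding sample using finite_set_component_pmf by simp
  note int = integrable_measure_pmf_finite[OF fin]
  have E1: "measure_pmf.expectation (mcs_sample \<Psi>) (\<lambda>y. y) = ?F"
    unfolding sample integral_map_pmf
    using expectation_component_pmf[of b] by (simp only: failure_frequency_eq_sum_Pow b_def)
  have "measure_pmf.expectation (mcs_sample \<Psi>) (\<lambda>y. y\<^sup>2) = (\<Sum>I\<in>Pow E. state_prob \<Psi> I * (b I)\<^sup>2)"
    unfolding sample integral_map_pmf using expectation_component_pmf[of "\<lambda>I. (b I)\<^sup>2"] by simp
  also have "\<dots> \<le> (\<Sum>I\<in>Pow E. \<mu> * (state_prob \<Psi> I * b I))"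
  proof (rule sum_mono)
    fix I assume I: "I \<in> Pow E"
    have "0 \<le> b I" "b I \<le> \<mu>"
      using rate_balance_bounds[of I] I balance_bound_pos total_repair_rate_pos by (auto simp: b_def)
    then have "(b I)\<^sup>2 \<le> \<mu> * b I" by (simp add: power2_eq_square mult_right_mono)
    then show "state_prob \<Psi> I * (b I)\<^sup>2 \<le> \<mu> * (state_prob \<Psi> I * b I)"
      using state_prob_nonneg[of I] I mult_left_mono[of "(b I)\<^sup>2" "\<mu> * b I" "state_prob \<Psi> I"]
      by (simp add: mult_ac)
  qed
  also have "\<dots> = \<mu> * ?F"
    unfolding failure_frequency_eq_sum_Pow b_def sum_distrib_left ..
  finally have E2: "measure_pmf.expectation (mcs_sample \<Psi>) (\<lambda>y. y\<^sup>2) \<le> \<mu> * ?F" .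
  have "measure_pmf.expectation (mcs_sample \<Psi>) (\<lambda>y. (y - ?F)\<^sup>2) =
      measure_pmf.expectation (mcs_sample \<Psi>) (\<lambda>y. y\<^sup>2)
      - 2 * ?F * measure_pmf.expectation (mcs_sample \<Psi>) (\<lambda>y. y) + ?F\<^sup>2"
    by (simp add: power2_diff int mult.commute)
  then have var: "measure_pmf.expectation (mcs_sample \<Psi>) (\<lambda>y. (y - ?F)\<^sup>2) \<le> \<mu> * ?F"
    using E1 E2 zero_le_square[of ?F]
    by (simp only: power2_eq_square mult.assoc)
  define d where "d = set_prob \<Psi> C * balance_bound"
  have d: "d > 0"
    unfolding d_def using set_prob_pos[OF cutset_subset[OF assms(1)]] balance_bound_pos by simp
  have "d \<le> P_fail * balance_bound"
    unfolding d_def using set_prob_le_P_fail[OF assms(1)] balance_bound_pos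
    by (intro mult_right_mono) auto
  then have dF: "d \<le> ?F" using balance_bound_P_fail_le by (simp add: mult.commute)
  \<comment> \<open>Together with \<open>2 + \<epsilon> \<ge> 2\<close> this supplies the factor
    \<open>4\<close> of the variance condition.\<close>
  have ln8: "ln (8 :: real) \<ge> 2"
  proof -
    have "exp (1 :: real) ^ 2 \<le> 2.8 ^ 2" using e_less_272 by (intro power_mono) auto
    then have "exp (2 :: real) \<le> 8" by (simp add: exp_double[of 1, simplified] power2_eq_square)
    then show ?thesis by (simp add: ln_ge_iff)
  qed
  define q where "q = \<mu> * (2 + \<epsilon>) * ln 8 / (d * \<epsilon>\<^sup>2)"
  have q: "q > 0" unfolding q_def using assms(2) d total_repair_rate_pos by (intro divide_pos_pos mult_pos_pos) auto
  have S: "real S \<ge> q" "S > 0"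
    using q unfolding S_def d_def[symmetric] q_def[symmetric] by (auto simp: real_nat_ceiling_ge)
  have "4 * \<mu> \<le> \<mu> * ((2 + \<epsilon>) * ln 8)"
    using mult_mono[of 2 "2 + \<epsilon>" 2 "ln 8"] ln8 assms(2) total_repair_rate_pos by simp
  also have "\<dots> = q * (d * \<epsilon>\<^sup>2)" using d assms(2) by (simp add: q_def)
  also have "\<dots> \<le> real S * (?F * \<epsilon>\<^sup>2)"
    using S dF d q by (intro mult_mono mult_right_mono mult_nonneg_nonneg) auto
  finally have "4 * \<mu> * ?F \<le> real S * (?F * \<epsilon>\<^sup>2) * ?F"
    using failure_frequency_pos by (intro mult_right_mono) auto
  then have "4 * measure_pmf.expectation (mcs_sample \<Psi>) (\<lambda>y. (y - ?F)\<^sup>2) \<le> real S * (\<epsilon> * ?F)\<^sup>2"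
    using var by (simp add: power2_eq_square mult_ac)
  then show ?thesis
    unfolding is_approximation_def mcs_def using assms(2-4) failure_frequency_pos S
    by (intro median_of_means_deviation fin E1) auto
qed

subsection \<open>Truncation to the light cutsets\<close>

text \<open>The choice of \<open>\<alpha>\<close> turns the exponent of the tail bound into the
  minimum weight plus \<open>ln L\<close>, so the ignored cutsets sum to at most
  \<open>\<xi> / 2 * set_prob \<Psi> C\<close>, shrunk by \<open>(\<mu> - \<mu>C) / \<mu>s\<close>.
  The shrinking serves the second claim: an ignored \<open>Z_clause\<close> carries a factor of at
  most \<open>\<mu>s / \<mu>\<close>, and the product is
  \<open>\<xi> / 2 * Z_prob \<Psi> C\<close>.\<close>

lemma truncation_error:
  assumes C: "min_weight_cutset \<Psi> C" and p: "set_prob \<Psi> C \<le> real (card (nodes \<Psi>)) powr (-4)"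
    and "\<xi> > 0"
  defines "\<mu>C \<equiv> \<Sum>i\<in>C. repair_rate \<Psi> i"
    and "\<gamma> \<equiv> min_weight \<Psi> / ln (real (card (nodes \<Psi>))) - 2"
  defines "\<alpha> \<equiv> 1 + 2 / \<gamma> +
      ln (2 * (\<gamma> + 2) * (\<mu> - size_bound * min_repair_rate \<Psi>) / (\<xi> * \<gamma> * (\<mu> - \<mu>C))) /
      (\<gamma> * ln (real (card (nodes \<Psi>))))"
  defines "J \<equiv> approx_min_cutsets \<Psi> \<alpha>"
  shows "P_fail - measure_pmf.prob (assignment_pmf \<Psi>) (\<Union>C\<in>J. X_clause C) \<le> \<xi> / 2 * P_fail"
    and "P_stay - measure_pmf.prob (assignment_pmf \<Psi>) (\<Union>C\<in>J. Z_clause C) \<le> \<xi> / 2 * P_stay"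
proof -
  let ?n = "real (card (nodes \<Psi>))"
  let ?w = "min_weight \<Psi>"
  have CC: "C \<in> cutsets \<Psi>" "set_weight \<Psi> C = ?w" using C by (auto simp: min_weight_cutset_def)
  define l where "l = ln ?n"
  have l: "l > 0" using card_nodes_ge_2 by (simp add: l_def)
  have pC: "set_prob \<Psi> C = exp (- ?w)" using set_prob_eq_exp[OF cutset_subset[OF CC(1)]] CC(2) by simp
  have "exp (- ?w) \<le> exp (- 4 * l)"
    using p card_nodes_ge_2 unfolding pC by (simp add: powr_def l_def mult.commute)
  \<comment> \<open>The branch condition of the algorithm in logarithmic form; it yields
    \<open>\<gamma> \<ge> 2\<close> and hence a convergent tail.\<close>
  then have w4: "?w \<ge> 4 * l" by simp
  have \<gamma>: "\<gamma> \<ge> 2" "?w = (\<gamma> + 2) * l" using w4 l by (auto simp: \<gamma>_def l_def[symmetric] field_simps)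
  \<comment> \<open>An upper bound on the total repair rate outside any cutset;
    \<open>\<mu> - \<mu>C\<close> is the exact value for \<open>C\<close>.\<close>
  define \<mu>s where "\<mu>s = \<mu> - size_bound * min_repair_rate \<Psi>"
  have \<mu>C: "\<mu> - \<mu>C > 0" using cutset_repair_rate_less[OF CC(1)] by (simp add: \<mu>C_def)
  have \<mu>s: "\<mu> - \<mu>C \<le> \<mu>s" using size_bound_repair_rate_le[OF CC(1)] by (simp add: \<mu>s_def \<mu>C_def)
  define L where "L = 2 * (\<gamma> + 2) * \<mu>s / (\<xi> * \<gamma> * (\<mu> - \<mu>C))"
  have L: "L > 0" unfolding L_def using \<gamma> \<mu>C \<mu>s assms(3) by (intro divide_pos_pos mult_pos_pos) auto
  define \<kappa> where "\<kappa> = 2 * l / ?w"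
  have "\<kappa> = 2 / (\<gamma> + 2)" unfolding \<kappa>_def \<gamma>(2) using l by simp
  then have \<kappa>: "1 - \<kappa> = \<gamma> / (\<gamma> + 2)" using \<gamma>(1) by (simp add: field_simps)
  have \<alpha>: "\<alpha> = 1 + 2 / \<gamma> + ln L / (\<gamma> * l)" by (simp add: \<alpha>_def L_def \<mu>s_def l_def)
  have "(1 - \<kappa>) * (\<alpha> * ?w) = \<alpha> * \<gamma> * l" unfolding \<kappa> \<gamma>(2) using \<gamma> by (simp add: field_simps)
  also have "\<dots> = ?w + ln L" unfolding \<alpha> \<gamma>(2) using \<gamma> l by (simp add: field_simps)
  finally have ex: "- (1 - \<kappa>) * (\<alpha> * ?w) = - ?w - ln L"
    by (simp only: mult_minus_left minus_add_distrib)
  define tail where "tail = (\<Sum>D\<in>cutsets \<Psi> - J. set_prob \<Psi> D)"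
  have "tail \<le> exp (- (1 - \<kappa>) * (\<alpha> * ?w)) / (1 - \<kappa>)"
    unfolding tail_def J_def \<kappa>_def l_def using w4 l
    by (intro sum_set_prob_heavy_cutsets_le) (simp add: l_def[symmetric])
  also have "\<dots> = set_prob \<Psi> C / L / (1 - \<kappa>)"
    unfolding ex pC using L by (simp add: exp_diff)
  also have "\<dots> = set_prob \<Psi> C / L * ((\<gamma> + 2) / \<gamma>)"
    unfolding \<kappa> by simp
  \<comment> \<open>The factor \<open>(\<gamma> + 2) / \<gamma>\<close> in \<open>L\<close> is there
    to cancel \<open>1 / (1 - \<kappa>)\<close>.\<close>
  also have "\<dots> = \<xi> / 2 * set_prob \<Psi> C * ((\<mu> - \<mu>C) / \<mu>s)"
  proof -
    have "q / (2 * g * s / (x * c * v)) * (g / c) = x / 2 * q * (v / s)"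
      if "g \<noteq> 0" "s \<noteq> 0" "x \<noteq> 0" "c \<noteq> 0" "v \<noteq> 0" for q g s x c v :: real
      using that by (simp add: field_simps)
    note cancel = this
    show ?thesis unfolding L_def by (rule cancel) (use \<gamma>(1) \<mu>C \<mu>s assms(3) in auto)
  qed
  finally have tail: "tail \<le> \<xi> / 2 * set_prob \<Psi> C * ((\<mu> - \<mu>C) / \<mu>s)" .
  have sp: "set_prob \<Psi> C > 0" using set_prob_pos[OF cutset_subset[OF CC(1)]] .
  have "P_fail - measure_pmf.prob (assignment_pmf \<Psi>) (\<Union>C\<in>J. X_clause C) \<le>
      (\<Sum>D\<in>cutsets \<Psi> - J. measure_pmf.prob (assignment_pmf \<Psi>) (X_clause D))"
    unfolding P_fail_def using prob_UN_le_prob_UN_subset[OF finite_cutsets, of "assignment_pmf \<Psi>" X_clause J]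
    by simp
  also have "\<dots> = tail"
    unfolding tail_def using prob_X_clause cutset_subset by (intro sum.cong) (auto simp: X_prob_def)
  also note tail
  also have "\<xi> / 2 * set_prob \<Psi> C * ((\<mu> - \<mu>C) / \<mu>s) \<le> \<xi> / 2 * set_prob \<Psi> C * 1"
    using \<mu>s \<mu>C sp assms(3) by (intro mult_left_mono) auto
  also have "\<dots> \<le> \<xi> / 2 * P_fail"
    using set_prob_le_P_fail[OF CC(1)] assms(3) by simp
  finally show "P_fail - measure_pmf.prob (assignment_pmf \<Psi>) (\<Union>C\<in>J. X_clause C) \<le> \<xi> / 2 * P_fail" .
  have "P_stay - measure_pmf.prob (assignment_pmf \<Psi>) (\<Union>C\<in>J. Z_clause C) \<le>
      (\<Sum>D\<in>cutsets \<Psi> - J. measure_pmf.prob (assignment_pmf \<Psi>) (Z_clause D))"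
    unfolding P_stay_def using prob_UN_le_prob_UN_subset[OF finite_cutsets, of "assignment_pmf \<Psi>" Z_clause J]
    by simp
  also have "\<dots> \<le> (\<Sum>D\<in>cutsets \<Psi> - J. set_prob \<Psi> D * (\<mu>s / \<mu>))"
  proof (rule sum_mono)
    fix D assume "D \<in> cutsets \<Psi> - J"
    then have D: "D \<in> cutsets \<Psi>" by simp
    have "1 - (\<Sum>i\<in>D. repair_rate \<Psi> i / \<mu>) \<le> \<mu>s / \<mu>"
      using size_bound_repair_rate_le[OF D] total_repair_rate_pos
      by (simp add: sum_divide_distrib[symmetric] \<mu>s_def field_simps)
    then show "measure_pmf.prob (assignment_pmf \<Psi>) (Z_clause D) \<le> set_prob \<Psi> D * (\<mu>s / \<mu>)"
      unfolding prob_Z_clause[OF cutset_subset[OF D]] Z_prob_def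
      using set_prob_pos[OF cutset_subset[OF D]] by (intro mult_left_mono) auto
  qed
  also have "\<dots> = tail * (\<mu>s / \<mu>)" by (simp only: tail_def sum_distrib_right)
  also have "\<dots> \<le> \<xi> / 2 * set_prob \<Psi> C * ((\<mu> - \<mu>C) / \<mu>s) * (\<mu>s / \<mu>)"
    using \<mu>C \<mu>s total_repair_rate_pos by (intro mult_right_mono tail) auto
  also have "\<dots> = \<xi> / 2 * Z_prob \<Psi> C"
    using \<mu>C \<mu>s total_repair_rate_pos
    by (simp add: Z_prob_def sum_divide_distrib[symmetric] \<mu>C_def[symmetric] field_simps)
  also have "\<dots> \<le> \<xi> / 2 * P_stay"
    using Z_prob_le_P_stay[OF CC(1)] assms(3) by simp
  finally show "P_stay - measure_pmf.prob (assignment_pmf \<Psi>) (\<Union>C\<in>J. Z_clause C) \<le> \<xi> / 2 * P_stay" .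
qed

text \<open>Sampling and truncation each cost \<open>\<xi> / 2\<close>, so the difference is off by
  less than \<open>2 * \<xi> * P_fail\<close>; the definition of \<open>\<xi>\<close> converts this,
  times \<open>\<mu>\<close>, into \<open>\<epsilon> * balance_bound * P_fail\<close>. Each run
  fails with probability at most \<open>\<delta> / 2\<close>.\<close>

lemma klm_difference_deviation:
  assumes J: "J \<subseteq> cutsets \<Psi>" and "\<epsilon> > 0" "0 < \<delta>" "\<delta> < 1"
  defines "\<xi> \<equiv> \<epsilon> / 2 * (balance_bound / \<mu>)"
  assumes X: "P_fail - measure_pmf.prob (assignment_pmf \<Psi>) (\<Union>C\<in>J. X_clause C) \<le> \<xi> / 2 * P_fail"
    and Z: "P_stay - measure_pmf.prob (assignment_pmf \<Psi>) (\<Union>C\<in>J. Z_clause C) \<le> \<xi> / 2 * P_stay"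
  shows "is_approximation
    (map_pmf (\<lambda>(a, b). (a - b) * \<mu>)
      (pair_pmf
        (klm_estimator (assignment_pmf \<Psi>) J X_clause (X_prob \<Psi>) (\<xi> / 2) (\<delta> / 2))
        (klm_estimator (assignment_pmf \<Psi>) J Z_clause (Z_prob \<Psi>) (\<xi> / 2) (\<delta> / 2))))
    (failure_frequency \<Psi>) \<epsilon> \<delta>"
proof -
  let ?F = "failure_frequency \<Psi>"
  let ?D = "assignment_pmf \<Psi>"
  let ?KX = "klm_estimator ?D J X_clause (X_prob \<Psi>) (\<xi> / 2) (\<delta> / 2)"
  let ?KZ = "klm_estimator ?D J Z_clause (Z_prob \<Psi>) (\<xi> / 2) (\<delta> / 2)"
  define A where "A = measure_pmf.prob ?D (\<Union>C\<in>J. X_clause C)"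
  define B where "B = measure_pmf.prob ?D (\<Union>C\<in>J. Z_clause C)"
  have \<xi>: "\<xi> > 0" using assms(2) balance_bound_pos total_repair_rate_pos by (simp add: \<xi>_def)
  have finJ: "finite J" using J finite_cutsets finite_subset by blast
  have JE: "C \<subseteq> E" if "C \<in> J" for C using that J cutset_subset by blast
  have KX: "measure_pmf.prob ?KX {y. \<bar>y - A\<bar> > \<xi> / 2 * A} \<le> \<delta> / 2"
    unfolding A_def using \<xi> assms(3,4) finJ JE
    by (intro klm_estimator_deviation finite_set_assignment_pmf)
       (auto simp: prob_X_clause X_prob_def set_prob_pos)
  have KZ: "measure_pmf.prob ?KZ {y. \<bar>y - B\<bar> > \<xi> / 2 * B} \<le> \<delta> / 2"
    unfolding B_def using \<xi> assms(3,4) finJ JE J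
    by (intro klm_estimator_deviation finite_set_assignment_pmf) (auto simp: prob_Z_clause intro: Z_prob_pos)
  have A: "A \<le> P_fail" unfolding A_def P_fail_def using J by (intro measure_pmf.finite_measure_mono) auto
  have B: "B \<le> P_stay" unfolding B_def P_stay_def using J by (intro measure_pmf.finite_measure_mono) auto
  have good: "\<bar>(a - b) * \<mu> - ?F\<bar> < \<epsilon> * ?F"
    if a: "\<bar>a - A\<bar> \<le> \<xi> / 2 * A" and b: "\<bar>b - B\<bar> \<le> \<xi> / 2 * B" for a b
  proof -
    have "\<xi> / 2 * A \<le> \<xi> / 2 * P_fail" "\<xi> / 2 * B \<le> \<xi> / 2 * P_stay"
      using A B \<xi> by (auto intro!: mult_left_mono)
    then have "\<bar>a - P_fail\<bar> \<le> \<xi> * P_fail" "\<bar>b - P_stay\<bar> \<le> \<xi> * P_stay"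
      using a b A B X Z unfolding A_def[symmetric] B_def[symmetric] by linarith+
    moreover have "\<xi> * P_stay < \<xi> * P_fail" using P_stay_less_P_fail \<xi> by simp
    ultimately have "\<bar>(a - b) - (P_fail - P_stay)\<bar> < 2 * (\<xi> * P_fail)" by linarith
    then have "\<bar>(a - b) - (P_fail - P_stay)\<bar> * \<mu> < 2 * (\<xi> * P_fail) * \<mu>"
      using total_repair_rate_pos by (intro mult_strict_right_mono) auto
    also have "\<bar>(a - b) - (P_fail - P_stay)\<bar> * \<mu> = \<bar>(a - b) * \<mu> - ?F\<bar>"
      unfolding failure_frequency_eq left_diff_distrib[symmetric] abs_mult
      using total_repair_rate_pos by simp
    also have "2 * (\<xi> * P_fail) * \<mu> = \<epsilon> * (balance_bound * P_fail)"
      using total_repair_rate_pos by (simp add: \<xi>_def)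
    also have "\<dots> \<le> \<epsilon> * ?F" using balance_bound_P_fail_le assms(2) by (intro mult_left_mono) auto
    finally show ?thesis .
  qed
  let ?P = "pair_pmf ?KX ?KZ"
  have "measure_pmf.prob ?P ((\<lambda>(a, b). (a - b) * \<mu>) -` {y. \<bar>y - ?F\<bar> \<ge> \<epsilon> * ?F}) \<le>
      measure_pmf.prob ?P (fst -` {y. \<bar>y - A\<bar> > \<xi> / 2 * A} \<union> snd -` {y. \<bar>y - B\<bar> > \<xi> / 2 * B})"
    using good by (intro measure_pmf.finite_measure_mono) (force simp: not_less[symmetric])+
  also have "\<dots> \<le> measure_pmf.prob ?P (fst -` {y. \<bar>y - A\<bar> > \<xi> / 2 * A}) +
      measure_pmf.prob ?P (snd -` {y. \<bar>y - B\<bar> > \<xi> / 2 * B})"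
    by (intro measure_Un_le) auto
  also have "\<dots> \<le> \<delta> / 2 + \<delta> / 2"
    unfolding measure_map_pmf[symmetric] map_fst_pair_pmf map_snd_pair_pmf
    by (intro add_mono KX KZ)
  finally show ?thesis by (simp add: is_approximation_def)
qed

end

section \<open>Correctness of both branches of the algorithm\<close>

theorem theorem2:
  fixes \<Psi> :: "'v rel_system" and Cmin :: "nat set" and \<epsilon> \<delta> :: real
  assumes "reliability_system \<Psi>"
    and "min_repair_rate \<Psi> / max_fail_rate \<Psi> > real (comps \<Psi>) - 1"
    and "card (cutsets \<Psi>) > 1"
    and "min_weight_cutset \<Psi> Cmin"
    and "\<epsilon> > 0" and "0 < \<delta>" and "\<delta> < 1"
  shows "is_approximation (algorithm_B \<Psi> Cmin \<epsilon> \<delta>) (failure_frequency \<Psi>) \<epsilon> \<delta>"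
proof -
  interpret repairable_network \<Psi> using assms(1-3) by unfold_locales
  have C: "Cmin \<in> cutsets \<Psi>" "set_weight \<Psi> Cmin = min_weight \<Psi>"
    using assms(4) by (auto simp: min_weight_cutset_def)
  have sub: "approx_min_cutsets \<Psi> \<alpha> \<subseteq> cutsets \<Psi>" for \<alpha> by (auto simp: approx_min_cutsets_def)
  have \<xi>: "\<epsilon> / 2 * (balance_bound / total_repair_rate \<Psi>) > 0"
    using assms(5) balance_bound_pos total_repair_rate_pos by simp
  \<comment> \<open>With the weight of \<open>Cmin\<close> replaced by the minimum weight, the local
    \<open>s\<close> and \<open>\<rho>\<close> of the algorithm become \<open>size_bound\<close> and
    \<open>balance_bound\<close>.\<close>
  note unfold = algorithm_B_def Let_def C(2) size_bound_def[symmetric] balance_bound_def[symmetric]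
  show ?thesis
  proof (cases "set_prob \<Psi> Cmin > real (card (nodes \<Psi>)) powr (-4)")
    case True
    then show ?thesis unfolding unfold using mcs_deviation[OF C(1) assms(5-7)] by (simp only: if_True)
  next
    case False
    then have "set_prob \<Psi> Cmin \<le> real (card (nodes \<Psi>)) powr (-4)" by simp
    note klm_difference_deviation[OF sub assms(5-7) truncation_error[OF assms(4) this \<xi>]]
    then show ?thesis unfolding unfold using False by (simp only: if_False)
  qed
qed

end
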